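(* Let $\Gamma_\delta$ be a marked finite compact metric graph with $N$ vertices, in which $V_1,\dots,V_{N_1}$ are of $\delta$ type and $V_{N_1+1},\dots,V_N$ are of $\delta'$ type, and let $\gamma_i=\deg V_i$. Let $A_{\vec\alpha}$ and $A_{\vec{\widetilde\alpha}}$ be two graph Laplacians on $\Gamma_\delta$ with real coupling constants $\vec\alpha=(\alpha_1,\dots,\alpha_N)$ and $\vec{\widetilde\alpha}=(\widetilde\alpha_1,\dots,\widetilde\alpha_N)$ respectively. If the (point) spectra of $A_{\vec\alpha}$ and $A_{\vec{\widetilde\alpha}}$ coincide counting multiplicities, then for every $m=1,2,3,\dots$ $$\sum_{i=1}^{N_1}\frac{(-\alpha_i)^m}{\gamma_i^m}+\sum_{\substack{i=N_1+1\\ \alpha_i\neq 0}}^{N}\frac{\gamma_i^m}{\alpha_i^m}=\sum_{i=1}^{N_1}\frac{(-\widetilde\alpha_i)^m}{\gamma_i^m}+\sum_{\substack{i=N_1+1\\ \widetilde\alpha_i\neq 0}}^{N}\frac{\gamma_i^m}{\widetilde\alpha_i^m}.$$ Moreover, the number of indices $i\in\{N_1+1,\dots,N\}$ with $\alpha_i=0$ equals the number of indices $i\in\{N_1+1,\dots,N\}$ with $\widetilde\alpha_i=0$.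
   Context: A finite compact metric graph $\Gamma$ consists of a finite non-empty collection of compact intervals $\Delta_j=[x_{2j-1},x_{2j}]$, $j=1,\dots,n$ (the edges), together with a partition of the set of endpoints $\{x_k\}_{k=1}^{2n}$ into $N$ classes $V_1,\dots,V_N$ (the vertices); loops and multiple edges are allowed. The valence (degree) $\gamma_m=\deg V_m$ is the number of endpoints belonging to $V_m$; a vertex of valence greater than 1 is called internal. Put $L_2(\Gamma)=\bigoplus_{j=1}^n L_2(\Delta_j)$ and $W_2^2(\Gamma)=\bigoplus_{j=1}^n W_2^2(\Delta_j)$ (Sobolev spaces). For $f\in W_2^2(\Gamma)$ the normal derivative at an endpoint is $\partial_n f(x_j)=f'(x_j)$ if $x_j$ is the left endpoint of its edge and $\partial_n f(x_j)=-f'(x_j)$ if it is the right endpoint. Put $f^\Sigma(V_k)=\sum_{x_j\in V_k}f(x_j)$ and $\partial_n^\Sigma f(V_k)=\sum_{x_j\in V_k}\partial_n f(x_j)$. A marked graph $\Gamma_\delta$ is a graph $\Gamma$ in which each vertex is assigned one of the two types $\delta$ or $\delta'$. Let $\mathcal D(\Gamma_\delta)$ be the set of all $f\in W_2^2(\Gamma)$ such that $f(x_i)=f(x_j)$ for all $x_i,x_j\in V$ at every internal vertex $V$ of $\delta$ type, and $\partial_n f(x_i)=\partial_n f(x_j)$ for all $x_i,x_j\in V$ at every internal vertex $V$ of $\delta'$ type. For $\vec\alpha=(\alpha_1,\dots,\alpha_N)\in\mathbb R^N$ (coupling constants), the graph Laplacian $A_{\vec\alpha}$ is the operator in $L_2(\Gamma)$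 acting on each edge as $-\frac{d^2}{dx^2}$, with domain consisting of all $f\in\mathcal D(\Gamma_\delta)$ such that for every $k$: $\partial_n^\Sigma f(V_k)=\frac{\alpha_k}{\gamma_k}f^\Sigma(V_k)$ if $V_k$ is of $\delta$ type, and $f^\Sigma(V_k)=-\frac{\alpha_k}{\gamma_k}\partial_n^\Sigma f(V_k)$ if $V_k$ is of $\delta'$ type. It is self-adjoint with purely discrete spectrum accumulating only at $+\infty$. *)

theory Defs
  imports "HOL-Analysis.Analysis" "HOL-Library.Disjoint_Sets" "HOL-Library.Function_Algebras"
begin

section \<open>Marked metric graphs\<close>

datatype vertex_type = Delta | Delta_prime

text \<open>
  Edges are numbered \<open>1..n\<close>, their endpoints \<open>1..2n\<close> and the vertices \<open>1..N\<close>.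
  Edge \<open>j\<close> is the interval from \<open>endpoint G (2 * j - 1)\<close> to \<open>endpoint G (2 * j)\<close>.  The intervals are
  separate copies, so a vertex is a set of endpoint \<^emph>\<open>indices\<close>: two different endpoints may have the
  same real coordinate.  Values of the fields outside these index ranges are irrelevant.
\<close>

record marked_graph =
  num_edges :: nat
  endpoint :: "nat \<Rightarrow> real"
  num_vertices :: nat
  vertex :: "nat \<Rightarrow> nat set"
  vertex_mark :: "nat \<Rightarrow> vertex_type"

definition is_marked_graph :: "marked_graph \<Rightarrow> bool" where
  "is_marked_graph G \<longleftrightarrow>
     1 \<le> num_edges G \<and>
     (\<forall>j\<in>{1..num_edges G}. endpoint G (2 * j - 1) < endpoint G (2 * j)) \<and>
     inj_on (vertex G) {1..num_vertices G} \<and>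
     partition_on {1..2 * num_edges G} (vertex G ` {1..num_vertices G})"

definition edge :: "marked_graph \<Rightarrow> nat \<Rightarrow> real set" where
  "edge G j = {endpoint G (2 * j - 1)..endpoint G (2 * j)}"

text \<open>Endpoints \<open>2 * j - 1\<close> and \<open>2 * j\<close> belong to edge \<open>j\<close>.\<close>

definition endpoint_edge :: "nat \<Rightarrow> nat" where
  "endpoint_edge k = (k + 1) div 2"

definition valence :: "marked_graph \<Rightarrow> nat \<Rightarrow> nat" where
  "valence G m = card (vertex G m)"

definition internal :: "marked_graph \<Rightarrow> nat \<Rightarrow> bool" where
  "internal G m \<longleftrightarrow> valence G m > 1"


section \<open>Function spaces\<close>

text \<open>
  A function on the graph is a family \<open>f\<close> of complex functions, one per edge, set to zero off the
  graph.  With this convention two continuous functions on the edges that agree almost everywhere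
  are equal, so that elements of the Sobolev space \<open>W22\<close> below correspond one-to-one to classes
  modulo null sets.
\<close>

definition supported_on_graph :: "marked_graph \<Rightarrow> (nat \<Rightarrow> real \<Rightarrow> complex) \<Rightarrow> bool" where
  "supported_on_graph G f \<longleftrightarrow>
     (\<forall>j t. \<not> (j \<in> {1..num_edges G} \<and> t \<in> edge G j) \<longrightarrow> f j t = 0)"

definition L2_interval :: "real \<Rightarrow> real \<Rightarrow> (real \<Rightarrow> complex) set" where
  "L2_interval a b =
     {h. set_borel_measurable lebesgue {a..b} h \<and>
         set_integrable lebesgue {a..b} (\<lambda>t. (norm (h t))\<^sup>2)}"

text \<open>
  \<open>f\<close> is continuously differentiable on \<open>[a, b]\<close>, its derivative is absolutely continuous, and its
  almost everywhere defined second derivative is (represented by) \<open>h\<close> in \<open>L2\<close>; equivalently, \<open>h\<close> is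
  the weak second derivative of \<open>f\<close>.
\<close>

definition has_second_derivative_L2 ::
    "(real \<Rightarrow> complex) \<Rightarrow> (real \<Rightarrow> complex) \<Rightarrow> real \<Rightarrow> real \<Rightarrow> bool" where
  "has_second_derivative_L2 f h a b \<longleftrightarrow>
     h \<in> L2_interval a b \<and>
     (\<exists>f'. \<forall>t\<in>{a..b}. (f has_vector_derivative f' t) (at t within {a..b}) \<and>
                     f' t = f' a + (LINT s:{a..t}|lebesgue. h s))"

definition L2_graph :: "marked_graph \<Rightarrow> (nat \<Rightarrow> real \<Rightarrow> complex) set" where
  "L2_graph G =
     {g. supported_on_graph G g \<and>
         (\<forall>j\<in>{1..num_edges G}. g j \<in> L2_interval (endpoint G (2 * j - 1)) (endpoint G (2 * j)))}"

definition W22 :: "marked_graph \<Rightarrow> (nat \<Rightarrow> real \<Rightarrow> complex) set" where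
  "W22 G =
     {f. supported_on_graph G f \<and>
         (\<forall>j\<in>{1..num_edges G}.
            \<exists>h. has_second_derivative_L2 (f j) h (endpoint G (2 * j - 1)) (endpoint G (2 * j)))}"


section \<open>Boundary values and the graph Laplacian\<close>

definition end_value :: "marked_graph \<Rightarrow> (nat \<Rightarrow> real \<Rightarrow> complex) \<Rightarrow> nat \<Rightarrow> complex" where
  "end_value G f k = f (endpoint_edge k) (endpoint G k)"

text \<open>Odd endpoint indices are left endpoints.\<close>

definition normal_deriv :: "marked_graph \<Rightarrow> (nat \<Rightarrow> real \<Rightarrow> complex) \<Rightarrow> nat \<Rightarrow> complex" where
  "normal_deriv G f k =
     (if odd k then 1 else -1) *
     vector_derivative (f (endpoint_edge k)) (at (endpoint G k) within edge G (endpoint_edge k))"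

definition vertex_sum :: "marked_graph \<Rightarrow> (nat \<Rightarrow> real \<Rightarrow> complex) \<Rightarrow> nat \<Rightarrow> complex" where
  "vertex_sum G f m = (\<Sum>k\<in>vertex G m. end_value G f k)"

definition vertex_normal_sum :: "marked_graph \<Rightarrow> (nat \<Rightarrow> real \<Rightarrow> complex) \<Rightarrow> nat \<Rightarrow> complex" where
  "vertex_normal_sum G f m = (\<Sum>k\<in>vertex G m. normal_deriv G f k)"

definition graph_domain :: "marked_graph \<Rightarrow> (nat \<Rightarrow> real \<Rightarrow> complex) set" where
  "graph_domain G =
     {f \<in> W22 G.
        \<forall>m\<in>{1..num_vertices G}. internal G m \<longrightarrow>
          (case vertex_mark G m of
             Delta \<Rightarrow> \<forall>i\<in>vertex G m. \<forall>j\<in>vertex G m. end_value G f i = end_value G f j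
           | Delta_prime \<Rightarrow>
               \<forall>i\<in>vertex G m. \<forall>j\<in>vertex G m. normal_deriv G f i = normal_deriv G f j)}"

definition laplacian_domain ::
    "marked_graph \<Rightarrow> (nat \<Rightarrow> real) \<Rightarrow> (nat \<Rightarrow> real \<Rightarrow> complex) set" where
  "laplacian_domain G \<alpha> =
     {f \<in> graph_domain G.
        \<forall>m\<in>{1..num_vertices G}.
          (case vertex_mark G m of
             Delta \<Rightarrow>
               vertex_normal_sum G f m = of_real (\<alpha> m / real (valence G m)) * vertex_sum G f m
           | Delta_prime \<Rightarrow>
               vertex_sum G f m = - of_real (\<alpha> m / real (valence G m)) * vertex_normal_sum G f m)}"

text \<open>
  An operator in \<open>L2\<close> of the graph is given by its graph, a set of pairs \<open>(f, g)\<close> with image \<open>g\<close>.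
  Here \<open>f\<close> is the continuous representative of its class and \<open>g\<close> runs through all representatives
  of the class of \<open>A f\<close>.
\<close>

definition laplacian ::
    "marked_graph \<Rightarrow> (nat \<Rightarrow> real) \<Rightarrow>
       ((nat \<Rightarrow> real \<Rightarrow> complex) \<times> (nat \<Rightarrow> real \<Rightarrow> complex)) set" where
  "laplacian G \<alpha> =
     {(f, g). f \<in> laplacian_domain G \<alpha> \<and> g \<in> L2_graph G \<and>
        (\<forall>j\<in>{1..num_edges G}.
           has_second_derivative_L2 (f j) (\<lambda>t. - g j t)
             (endpoint G (2 * j - 1)) (endpoint G (2 * j)))}"


section \<open>Point spectrum with multiplicities\<close>

definition graph_scale :: "complex \<Rightarrow> (nat \<Rightarrow> real \<Rightarrow> complex) \<Rightarrow> nat \<Rightarrow> real \<Rightarrow> complex" where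
  "graph_scale c f = (\<lambda>j t. c * f j t)"

interpretation graph_fun: vector_space graph_scale
  by unfold_locales (auto simp: graph_scale_def fun_eq_iff algebra_simps)

definition eigenspace ::
    "((nat \<Rightarrow> real \<Rightarrow> complex) \<times> (nat \<Rightarrow> real \<Rightarrow> complex)) set \<Rightarrow> complex \<Rightarrow>
       (nat \<Rightarrow> real \<Rightarrow> complex) set" where
  "eigenspace A z = {f. (f, graph_scale z f) \<in> A}"

definition point_spectrum ::
    "((nat \<Rightarrow> real \<Rightarrow> complex) \<times> (nat \<Rightarrow> real \<Rightarrow> complex)) set \<Rightarrow> complex set" where
  "point_spectrum A = {z. \<exists>f\<in>eigenspace A z. f \<noteq> 0}"

definition eigenvalue_multiplicity ::
    "((nat \<Rightarrow> real \<Rightarrow> complex) \<times> (nat \<Rightarrow> real \<Rightarrow> complex)) set \<Rightarrow> complex \<Rightarrow> nat" where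
  "eigenvalue_multiplicity A z = vector_space.dim graph_scale (eigenspace A z)"

definition isospectral ::
    "((nat \<Rightarrow> real \<Rightarrow> complex) \<times> (nat \<Rightarrow> real \<Rightarrow> complex)) set \<Rightarrow>
     ((nat \<Rightarrow> real \<Rightarrow> complex) \<times> (nat \<Rightarrow> real \<Rightarrow> complex)) set \<Rightarrow> bool" where
  "isospectral A B \<longleftrightarrow>
     point_spectrum A = point_spectrum B \<and>
     (\<forall>z\<in>point_spectrum A. eigenvalue_multiplicity A z = eigenvalue_multiplicity B z)"

end

theory Submission
  imports Defs "HOL-Complex_Analysis.Complex_Analysis" "HOL-Real_Asymp.Real_Asymp"
    "HOL-Computational_Algebra.Fundamental_Theorem_Algebra" "Jordan_Normal_Form.Determinant"
begin

text \<open>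
  On one edge the equation \<open>-f'' = z f\<close> has a basis of two solutions that are entire in \<open>z\<close>.  Their
  coefficients on all edges form a vector of length \<open>2n\<close>, the vertex conditions become \<open>2n\<close> linear
  equations for it, and the determinant \<open>D\<^sub>\<alpha>(z)\<close> of this system (\<open>secular_det\<close>) is an entire function
  that vanishes exactly at the eigenvalues (\<open>eigenspace_eq_secular_kernel\<close>).
  Green's identity expresses that the Laplacian is symmetric; it shows that \<open>D\<^sub>\<alpha>\<close> has no zeros off the real axis, whatever the real coupling
  constants are (\<open>secular_det_nonreal\<close>), and that the order of each zero is the dimension of the
  eigenspace (\<open>secular_det_order\<close>).  For isospectral Laplacians the quotient \<open>q = D\<^sub>\<beta> / D\<^sub>\<alpha>\<close> is therefore
  an entire function without zeros.

  The quotient is constant, and no growth estimate is needed to see this.  A single coupling constant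
  enters one row of the matrix only, and affinely.  If a quotient of two determinants that differ in
  this constant had a value \<open>\<rho> \<le> 0\<close> at a nonreal point, then a real value of the constant between the
  two would make the determinant vanish there, which is excluded.  So each such quotient avoids the
  nonpositive reals off the real axis, where its principal logarithm is holomorphic with imaginary part
  of modulus at most \<open>\<pi>\<close>.  Changing \<open>\<alpha>\<close> into \<open>\<beta>\<close> one vertex at a time, an entire logarithm of \<open>q\<close> has
  bounded imaginary part, hence is constant (\<open>isospectral_secular_det\<close>).

  Now put \<open>z = -k\<^sup>2\<close> and let \<open>k\<close> tend to infinity.  In the basis of exponentials that decay away from
  one endpoint the edges decouple up to errors of size \<open>exp (-k l)\<close>, and up to such errors the
  determinant is a product of one polynomial factor for each vertex and of a nonzero factor that does
  not involve the coupling constants.  The polynomial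
  vanishes at \<open>k = -\<alpha>/\<gamma>\<close> for a \<open>\<delta>\<close> vertex and at \<open>k = \<gamma>/\<alpha>\<close> for a \<open>\<delta>'\<close> vertex with \<open>\<alpha> \<noteq> 0\<close>, and it is
  constant for a \<open>\<delta>'\<close> vertex with \<open>\<alpha> = 0\<close>.  Since the determinants are proportional, so are these
  polynomials (\<open>isospectral_vertex_factors\<close>).  Hence they have the same roots with multiplicities; the
  sums of the \<open>m\<close>-th powers of the roots agree, and so does the number of roots.
\<close>

hide_const (open) Determinants.det

section \<open>Determinants of matrices indexed by \<open>1..n\<close>\<close>

text \<open>
  Endpoints are numbered from \<open>1\<close>, matrix entries from \<open>0\<close>; this is the determinant of a family of
  entries in the numbering of the endpoints.
\<close>

definition square_det :: "nat \<Rightarrow> (nat \<Rightarrow> nat \<Rightarrow> complex) \<Rightarrow> complex" where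
  "square_det n F = Determinant.det (Matrix.mat n n (\<lambda>(i, j). F (Suc i) (Suc j)))"

lemma square_det_leibniz:
  "square_det n F =
     (\<Sum>p | p permutes {0..<n}. signof p * (\<Prod>i = 0..<n. F (Suc i) (Suc (p i))))"
proof -
  have "(\<Prod>i = 0..<n. Matrix.mat n n (\<lambda>(i, j). F (Suc i) (Suc j)) $$ (i, p i))
      = (\<Prod>i = 0..<n. F (Suc i) (Suc (p i)))" if "p permutes {0..<n}" for p
  proof (rule prod.cong)
    fix i assume "i \<in> {0..<n}"
    then show "Matrix.mat n n (\<lambda>(i, j). F (Suc i) (Suc j)) $$ (i, p i) = F (Suc i) (Suc (p i))"
      using permutes_in_image[OF that, of i] by simp
  qed simp
  then show ?thesis
    unfolding square_det_def by (subst det_def'[of _ n]) auto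
qed

lemma square_det_cong:
  assumes "\<And>r i. r \<in> {1..n} \<Longrightarrow> i \<in> {1..n} \<Longrightarrow> F r i = G r i"
  shows "square_det n F = square_det n G"
proof -
  have "Matrix.mat n n (\<lambda>(i, j). F (Suc i) (Suc j)) = Matrix.mat n n (\<lambda>(i, j). G (Suc i) (Suc j))"
    by (rule eq_matI) (auto intro: assms)
  then show ?thesis by (simp add: square_det_def)
qed

lemma sum_shift_one: "(\<Sum>i\<in>{1..n}. f i) = (\<Sum>i = 0..<n. f (Suc i))" for n :: nat
  by (simp add: sum.atLeast_Suc_atMost_Suc_shift atLeastLessThanSuc_atLeastAtMost
      sum.shift_bounds_Suc_ivl flip: sum.atLeast1_atMost_eq lessThan_atLeast0)

lemma square_det_mult:
  "square_det n (\<lambda>r i. \<Sum>k\<in>{1..n}. F r k * G k i) = square_det n F * square_det n G"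
proof -
  have "Matrix.mat n n (\<lambda>(i, j). \<Sum>k\<in>{1..n}. F (Suc i) k * G k (Suc j))
      = Matrix.mat n n (\<lambda>(i, j). F (Suc i) (Suc j)) * Matrix.mat n n (\<lambda>(i, j). G (Suc i) (Suc j))"
    by (rule eq_matI) (auto simp: scalar_prod_def sum_shift_one simp del: One_nat_def)
  then show ?thesis
    unfolding square_det_def by (simp add: det_mult[of _ n])
qed

lemma square_det_eq_0_iff:
  "square_det n F = 0 \<longleftrightarrow>
     (\<exists>y. (\<exists>i\<in>{1..n}. y i \<noteq> 0) \<and> (\<forall>r\<in>{1..n}. (\<Sum>i\<in>{1..n}. F r i * y i) = 0))"
    (is "?L \<longleftrightarrow> ?R")
proof -
  let ?A = "Matrix.mat n n (\<lambda>(i, j). F (Suc i) (Suc j))"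
  have row: "(?A *\<^sub>v v) $ i = (\<Sum>j\<in>{1..n}. F (Suc i) j * v $ (j - 1))"
    if "v \<in> carrier_vec n" "i < n" for v i
    using that by (auto simp: scalar_prod_def sum_shift_one simp del: One_nat_def)
  have L: "?L \<longleftrightarrow> (\<exists>v. v \<in> carrier_vec n \<and> v \<noteq> 0\<^sub>v n \<and> ?A *\<^sub>v v = 0\<^sub>v n)"
    unfolding square_det_def by (rule det_0_iff_vec_prod_zero) auto
  show ?thesis
  proof
    assume ?L
    then obtain v where v: "v \<in> carrier_vec n" "v \<noteq> 0\<^sub>v n" "?A *\<^sub>v v = 0\<^sub>v n"
      using L by blast
    obtain i where i: "i < n" "v $ i \<noteq> 0"
      using v(1,2) by (metis carrier_vecD eq_vecI index_zero_vec(1) index_zero_vec(2))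
    show ?R
    proof (intro exI[of _ "\<lambda>j. v $ (j - 1)"] conjI ballI)
      show "\<exists>i\<in>{1..n}. v $ (i - 1) \<noteq> 0"
        using i by (intro bexI[of _ "Suc i"]) auto
      fix r assume r: "r \<in> {1..n}"
      then have "(?A *\<^sub>v v) $ (r - 1) = 0" unfolding v(3) by auto
      then show "(\<Sum>i\<in>{1..n}. F r i * v $ (i - 1)) = 0"
        using row[OF v(1), of "r - 1"] r by auto
    qed
  next
    assume ?R
    then obtain y i where i: "i \<in> {1..n}" "y i \<noteq> 0"
      and y: "\<And>r. r \<in> {1..n} \<Longrightarrow> (\<Sum>i\<in>{1..n}. F r i * y i) = 0" by blast
    let ?v = "Matrix.vec n (\<lambda>j. y (Suc j))"
    have "?v $ (i - 1) \<noteq> 0\<^sub>v n $ (i - 1)" using i by auto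
    moreover have "?A *\<^sub>v ?v = 0\<^sub>v n"
    proof (rule eq_vecI)
      fix r assume "r < dim_vec (0\<^sub>v n)"
      then have r: "r < n" by simp
      have "(\<Sum>j\<in>{1..n}. F (Suc r) j * ?v $ (j - 1)) = (\<Sum>j\<in>{1..n}. F (Suc r) j * y j)"
        by (rule sum.cong) auto
      then show "(?A *\<^sub>v ?v) $ r = 0\<^sub>v n $ r"
        using row[of ?v r] y[of "Suc r"] r by (simp del: index_mult_mat_vec)
    qed auto
    ultimately show ?L using L by (metis vec_carrier)
  qed
qed

lemma square_det_scale_rows:
  "square_det n (\<lambda>r i. h r * F r i) = (\<Prod>r\<in>{1..n}. h r) * square_det n F"
proof -
  have "(\<Prod>r\<in>{1..n}. h r) = (\<Prod>i = 0..<n. h (Suc i))"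
    by (metis One_nat_def atLeastLessThanSuc_atLeastAtMost prod.shift_bounds_Suc_ivl)
  then show ?thesis
    by (simp add: square_det_leibniz prod.distrib sum_distrib_left mult_ac)
qed

lemma square_det_scale_columns:
  "square_det n (\<lambda>r i. h i * F r i) = (\<Prod>i\<in>{1..n}. h i) * square_det n F"
proof -
  have h: "(\<Prod>r\<in>{1..n}. h r) = (\<Prod>i = 0..<n. h (Suc i))"
    by (metis One_nat_def atLeastLessThanSuc_atLeastAtMost prod.shift_bounds_Suc_ivl)
  have "(\<Prod>i = 0..<n. h (Suc (p i))) = (\<Prod>i\<in>{1..n}. h i)" if "p permutes {0..<n}" for p
    unfolding h using prod.permute[OF that, of "\<lambda>i. h (Suc i)"] by (simp add: o_def)
  then show ?thesis
    by (simp add: square_det_leibniz prod.distrib sum_distrib_left mult_ac)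
qed

text \<open>
  Each product in the Leibniz formula contains exactly one entry of row \<open>r\<close>.
\<close>

lemma square_det_affine_in_row:
  assumes "r \<in> {1..n}"
  shows "\<exists>A B. \<forall>a. square_det n (\<lambda>i j. F i j + (if i = r then a * G j else 0)) = A + a * B"
proof -
  obtain s where s: "r = Suc s" "s < n" using assms by (cases r) auto
  let ?R = "\<lambda>p. \<Prod>i\<in>{0..<n} - {s}. F (Suc i) (Suc (p i))"
  have "(\<Prod>i = 0..<n. F (Suc i) (Suc (p i)) + (if Suc i = r then a * G (Suc (p i)) else 0))
      = (F r (Suc (p s)) + a * G (Suc (p s))) * ?R p" for a p
    using s by (subst prod.remove[of _ s]) (auto intro!: prod.cong)
  then have "square_det n (\<lambda>i j. F i j + (if i = r then a * G j else 0)) =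
      (\<Sum>p | p permutes {0..<n}. signof p * (F r (Suc (p s)) * ?R p)) +
      a * (\<Sum>p | p permutes {0..<n}. signof p * (G (Suc (p s)) * ?R p))" for a
    by (simp add: square_det_leibniz sum_distrib_left sum.distrib[symmetric] algebra_simps)
  then show ?thesis by blast
qed

lemma holomorphic_square_det:
  assumes "\<And>r i. r \<in> {1..n} \<Longrightarrow> i \<in> {1..n} \<Longrightarrow> (\<lambda>z. F z r i) holomorphic_on S"
  shows "(\<lambda>z. square_det n (F z)) holomorphic_on S"
  unfolding square_det_leibniz
proof (intro holomorphic_intros)
  fix p i assume "p \<in> {p. p permutes {0..<n}}" "i \<in> {0..<n}"
  then have "p i \<in> {0..<n}" by (auto simp: permutes_in_image[of p "{0..<n}" i] simp del: atLeastLessThan_iff)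
  then show "(\<lambda>z. F z (Suc i) (Suc (p i))) holomorphic_on S"
    using \<open>i \<in> {0..<n}\<close> by (intro assms) auto
qed

lemma tendsto_square_det:
  assumes "\<And>r i. r \<in> {1..n} \<Longrightarrow> i \<in> {1..n} \<Longrightarrow> ((\<lambda>z. F z r i) \<longlongrightarrow> L r i) A"
  shows "((\<lambda>z. square_det n (F z)) \<longlongrightarrow> square_det n L) A"
  unfolding square_det_leibniz
proof (intro tendsto_intros)
  fix p i assume "p \<in> {p. p permutes {0..<n}}" "i \<in> {0..<n}"
  then have "p i \<in> {0..<n}" by (auto simp: permutes_in_image[of p "{0..<n}" i] simp del: atLeastLessThan_iff)
  then show "((\<lambda>z. F z (Suc i) (Suc (p i))) \<longlongrightarrow> L (Suc i) (Suc (p i))) A"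
    using \<open>i \<in> {0..<n}\<close> by (intro assms) auto
qed

section \<open>Solutions of the eigenvalue equation on an edge\<close>

text \<open>
  This is \<open>cosh (sqrt w)\<close>, and the next function is \<open>sinh (sqrt w) / sqrt w\<close>.  The power series avoid the
  branch of the square root, so that the solutions below are entire in the energy \<open>z\<close>, also at \<open>z = 0\<close>.
\<close>

definition cosh_sqrt :: "complex \<Rightarrow> complex" where
  "cosh_sqrt w = (\<Sum>n. inverse (fact (2 * n)) * w ^ n)"

definition sinhc_sqrt :: "complex \<Rightarrow> complex" where
  "sinhc_sqrt w = (\<Sum>n. inverse (fact (2 * n + 1)) * w ^ n)"

lemma summable_fact_even: "summable (\<lambda>n. inverse (fact (2 * n)) * w ^ n :: complex)"
proof (rule summable_comparison_test)
  show "summable (\<lambda>n. inverse (fact n) * norm w ^ n)" 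
    using summable_exp[of "norm w"] by simp
  show "\<exists>N. \<forall>n\<ge>N. norm (inverse (fact (2 * n)) * w ^ n) \<le> inverse (fact n) * norm w ^ n"
    by (auto simp: norm_mult norm_power norm_inverse norm_fact fact_mono intro!: mult_right_mono le_imp_inverse_le)
qed

lemma summable_fact_odd: "summable (\<lambda>n. inverse (fact (2 * n + 1)) * w ^ n :: complex)"
proof (rule summable_comparison_test)
  show "summable (\<lambda>n. inverse (fact n) * norm w ^ n)" 
    using summable_exp[of "norm w"] by simp
  show "\<exists>N. \<forall>n\<ge>N. norm (inverse (fact (2 * n + 1)) * w ^ n) \<le> inverse (fact n) * norm w ^ n"
  proof (intro exI allI impI)
    fix n :: nat
    have "(fact n :: real) \<le> fact (2 * n + 1)" by (rule fact_mono) simp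
    then have "inverse (fact (2 * n + 1) :: real) \<le> inverse (fact n)" 
      by (intro le_imp_inverse_le) auto
    then show "norm (inverse (fact (2 * n + 1)) * w ^ n) \<le> inverse (fact n) * norm w ^ n"
      unfolding norm_mult norm_power norm_inverse norm_fact
      by (intro mult_right_mono) auto
  qed
qed

lemma DERIV_cosh_sqrt: "(cosh_sqrt has_field_derivative sinhc_sqrt w / 2) (at w)"
proof -
  have "((\<lambda>w. \<Sum>n. inverse (fact (2 * n)) * w ^ n) has_field_derivative
      (\<Sum>n. diffs (\<lambda>n. inverse (fact (2 * n))) n * w ^ n)) (at w :: complex filter)"
    by (rule termdiffs_strong_converges_everywhere) (rule summable_fact_even)
  moreover have "diffs (\<lambda>n. inverse (fact (2 * n))) n = (inverse (fact (2 * n + 1)) / 2 :: complex)" for n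
  proof -
    have "(fact (2 * Suc n) :: complex) = 2 * of_nat (Suc n) * fact (2 * n + 1)"
      by (simp add: algebra_simps)
    then show ?thesis
      unfolding diffs_def by (simp del: fact_Suc of_nat_Suc mult_Suc_right add: field_simps)
  qed
  moreover have "(\<Sum>n. (inverse (fact (2 * n + 1)) / 2) * w ^ n) = sinhc_sqrt w / 2"
    unfolding sinhc_sqrt_def using suminf_divide[OF summable_fact_odd, of w 2]
    by (simp add: field_simps)
  ultimately show ?thesis
    by (simp only: cosh_sqrt_def[abs_def])
qed

lemma sinhc_sqrt_field_differentiable: "sinhc_sqrt field_differentiable (at w)"
proof -
  have "((\<lambda>w. \<Sum>n. inverse (fact (2 * n + 1)) * w ^ n) has_field_derivative
      (\<Sum>n. diffs (\<lambda>n. inverse (fact (2 * n + 1))) n * w ^ n)) (at w :: complex filter)"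
    by (rule termdiffs_strong_converges_everywhere) (rule summable_fact_odd)
  then show ?thesis
    unfolding field_differentiable_def sinhc_sqrt_def[abs_def] by blast
qed

lemma holomorphic_sinhc_sqrt: "sinhc_sqrt holomorphic_on S"
  using sinhc_sqrt_field_differentiable by (auto simp: holomorphic_on_def 
      intro: field_differentiable_at_within)

lemma cosh_sqrt_square: "cosh_sqrt (x\<^sup>2) = cosh x"
proof -
  have "(\<lambda>n. if even n then x ^ n /\<^sub>R fact n else 0) sums cosh x"
    by (rule cosh_converges)
  then have "(\<lambda>n. if even (2*n) then x ^ (2*n) /\<^sub>R fact (2*n) else 0) sums cosh x"
    by (subst sums_mono_reindex) (auto simp: strict_mono_def image_iff elim!: evenE)
  then show ?thesis
    by (simp add: cosh_sqrt_def sums_iff scaleR_conv_of_real mult.commute flip: power_mult)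
qed

lemma sinhc_sqrt_square: "x * sinhc_sqrt (x\<^sup>2) = sinh x"
proof -
  have "(\<lambda>n. if even n then 0 else x ^ n /\<^sub>R fact n) sums sinh x"
    by (rule sinh_converges)
  then have "(\<lambda>n. if even (2*n+1) then 0 else x ^ (2*n+1) /\<^sub>R fact (2*n+1)) sums sinh x"
    by (subst sums_mono_reindex[where g = "\<lambda>n. 2 * n + 1"]) 
      (auto simp: strict_mono_def image_iff elim!: oddE)
  then have "(\<lambda>n. x * (inverse (fact (2*n+1)) * (x\<^sup>2) ^ n)) sums sinh x"
    by (simp add: scaleR_conv_of_real mult_ac flip: power_mult)
  moreover have "(\<lambda>n. x * (inverse (fact (2*n+1)) * (x\<^sup>2) ^ n)) sums (x * sinhc_sqrt (x\<^sup>2))"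
    unfolding sinhc_sqrt_def by (intro sums_mult summable_sums summable_fact_odd)
  ultimately show ?thesis using sums_unique2 by blast
qed

lemma cosh_sqrt_0 [simp]: "cosh_sqrt 0 = 1"
  using cosh_sqrt_square[of 0] by simp

lemma sinhc_sqrt_0 [simp]: "sinhc_sqrt 0 = 1"
  using powser_zero[of "\<lambda>n. inverse (fact (2 * n + 1))"] by (simp add: sinhc_sqrt_def)

text \<open>
  Compare two ways of differentiating \<open>x * sinhc_sqrt (x\<^sup>2) = sinh x\<close>.
\<close>

lemma sinhc_sqrt_times_deriv:
  "2 * w * deriv sinhc_sqrt w = cosh_sqrt w - sinhc_sqrt w"
proof (cases "w = 0")
  case False
  define x where "x = csqrt w"
  have x: "x\<^sup>2 = w" "x \<noteq> 0" using False by (auto simp: x_def)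
  have "((\<lambda>x. x * sinhc_sqrt (x\<^sup>2)) has_field_derivative
      sinhc_sqrt (x\<^sup>2) + x * (deriv sinhc_sqrt (x\<^sup>2) * (2 * x))) (at x)"
    by (auto intro!: derivative_eq_intros DERIV_chain2[where f = sinhc_sqrt]
        DERIV_deriv_iff_field_differentiable[THEN iffD2] sinhc_sqrt_field_differentiable)
  moreover have "((\<lambda>x. x * sinhc_sqrt (x\<^sup>2)) has_field_derivative cosh x) (at x)"
    unfolding sinhc_sqrt_square by (auto intro!: derivative_eq_intros)
  ultimately have "sinhc_sqrt (x\<^sup>2) + x * (deriv sinhc_sqrt (x\<^sup>2) * (2 * x)) = cosh x"
    by (rule DERIV_unique)
  then show ?thesis unfolding cosh_sqrt_square[symmetric] x(1)[symmetric]
    by (simp add: power2_eq_square algebra_simps)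
qed simp

lemma DERIV_sinhc_sqrt: "(sinhc_sqrt has_field_derivative deriv sinhc_sqrt w) (at w)"
  using DERIV_deriv_iff_field_differentiable sinhc_sqrt_field_differentiable by blast

lemma DERIV_deriv_sinhc_sqrt:
  "(deriv sinhc_sqrt has_field_derivative deriv (deriv sinhc_sqrt) w) (at w)"
  by (intro holomorphic_derivI[where S = UNIV] holomorphic_deriv holomorphic_sinhc_sqrt) auto

text \<open>
  The derivative of \<open>sinhc_sqrt_times_deriv\<close>; it yields the \<open>t\<close>-derivative of \<open>sinz_dz\<close> below.
\<close>

lemma sinhc_sqrt_second_deriv:
  "3 * deriv sinhc_sqrt w + 2 * w * deriv (deriv sinhc_sqrt) w = sinhc_sqrt w / 2"
proof -
  have "((\<lambda>w. 2 * w * deriv sinhc_sqrt w) has_field_derivative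
      2 * deriv sinhc_sqrt w + 2 * w * deriv (deriv sinhc_sqrt) w) (at w)"
    by (auto intro!: derivative_eq_intros DERIV_deriv_sinhc_sqrt)
  moreover have "((\<lambda>w. cosh_sqrt w - sinhc_sqrt w) has_field_derivative
      sinhc_sqrt w / 2 - deriv sinhc_sqrt w) (at w)"
    by (intro derivative_intros DERIV_cosh_sqrt DERIV_sinhc_sqrt)
  ultimately have "2 * deriv sinhc_sqrt w + 2 * w * deriv (deriv sinhc_sqrt) w
      = sinhc_sqrt w / 2 - deriv sinhc_sqrt w"
    unfolding sinhc_sqrt_times_deriv by (rule DERIV_unique)
  then show ?thesis by (simp add: algebra_simps)
qed

text \<open>
  The solutions of \<open>f'' = -z f\<close> with \<open>(f 0, f' 0) = (1, 0)\<close> and \<open>(0, 1)\<close>, that is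
  \<open>cos (sqrt z t)\<close> and \<open>sin (sqrt z t) / sqrt z\<close>.
\<close>

definition cosz :: "complex \<Rightarrow> real \<Rightarrow> complex" where
  "cosz z t = cosh_sqrt (- z * of_real t ^ 2)"

definition sinz :: "complex \<Rightarrow> real \<Rightarrow> complex" where
  "sinz z t = of_real t * sinhc_sqrt (- z * of_real t ^ 2)"

definition sinz_dz :: "complex \<Rightarrow> real \<Rightarrow> complex" where
  "sinz_dz z t = - (of_real t ^ 3) * deriv sinhc_sqrt (- z * of_real t ^ 2)"

lemma cosz_0 [simp]: "cosz z 0 = 1" and sinz_0 [simp]: "sinz z 0 = 0"
  and sinz_dz_0 [simp]: "sinz_dz z 0 = 0"
  by (simp_all add: cosz_def sinz_def sinz_dz_def)

lemma cosz_vector_derivative: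
  "(cosz z has_vector_derivative - z * sinz z t) (at t within S)"
proof -
  have "((\<lambda>x. cosh_sqrt (- z * x ^ 2)) has_field_derivative
      sinhc_sqrt (- z * of_real t ^ 2) / 2 * (- z * (2 * of_real t))) (at (of_real t))"
    by (rule DERIV_chain2[OF DERIV_cosh_sqrt]) (auto intro!: derivative_eq_intros)
  then have "((\<lambda>x. cosh_sqrt (- z * x ^ 2)) has_field_derivative - z * sinz z t) (at (of_real t))"
    by (simp add: sinz_def mult_ac)
  from has_vector_derivative_real_field[OF this, of S] show ?thesis
    by (simp add: cosz_def[abs_def])
qed

lemma sinz_vector_derivative:
  "(sinz z has_vector_derivative cosz z t) (at t within S)"
proof -
  let ?w = "- z * of_real t ^ 2"
  have "((\<lambda>x. x * sinhc_sqrt (- z * x ^ 2)) has_field_derivative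
      sinhc_sqrt ?w + of_real t * (deriv sinhc_sqrt ?w * (- z * (2 * of_real t)))) (at (of_real t))"
    by (rule DERIV_mult'[THEN DERIV_cong], rule DERIV_ident, rule DERIV_chain2[OF DERIV_sinhc_sqrt])
      (auto intro!: derivative_eq_intros)
  also have "sinhc_sqrt ?w + of_real t * (deriv sinhc_sqrt ?w * (- z * (2 * of_real t)))
      = sinhc_sqrt ?w + 2 * ?w * deriv sinhc_sqrt ?w"
    by (simp add: power2_eq_square)
  also have "\<dots> = cosz z t"
    unfolding sinhc_sqrt_times_deriv by (simp add: cosz_def)
  finally show ?thesis
    using has_vector_derivative_real_field[of "\<lambda>x. x * sinhc_sqrt (- z * x ^ 2)" _ t S]
    by (simp add: sinz_def[abs_def])
qed

lemma sinz_dz_vector_derivative: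
  "(sinz_dz z has_vector_derivative - (of_real t / 2) * sinz z t) (at t within S)"
proof -
  let ?w = "- z * of_real t ^ 2"
  have "((\<lambda>x. - (x ^ 3) * deriv sinhc_sqrt (- z * x ^ 2)) has_field_derivative
      - (3 * of_real t ^ 2) * deriv sinhc_sqrt ?w
      + - (of_real t ^ 3) * (deriv (deriv sinhc_sqrt) ?w * (- z * (2 * of_real t)))) (at (of_real t))"
    by (rule DERIV_mult'[THEN DERIV_cong, rotated], rule DERIV_chain2[OF DERIV_deriv_sinhc_sqrt])
      (auto intro!: derivative_eq_intros)
  also have "- (3 * of_real t ^ 2) * deriv sinhc_sqrt ?w
      + - (of_real t ^ 3) * (deriv (deriv sinhc_sqrt) ?w * (- z * (2 * of_real t)))
      = - (of_real t ^ 2) * (3 * deriv sinhc_sqrt ?w + 2 * ?w * deriv (deriv sinhc_sqrt) ?w)"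
    by (simp add: power2_eq_square power3_eq_cube algebra_simps)
  also have "\<dots> = - (of_real t / 2) * sinz z t"
    unfolding sinhc_sqrt_second_deriv by (simp add: sinz_def power2_eq_square)
  finally show ?thesis
    using has_vector_derivative_real_field[of "\<lambda>x. - (x ^ 3) * deriv sinhc_sqrt (- z * x ^ 2)" _ t S]
    by (simp add: sinz_dz_def[abs_def])
qed

lemma cosz_DERIV_z:
  "((\<lambda>z. cosz z t) has_field_derivative - (of_real t / 2) * sinz z t) (at z)"
proof -
  have "((\<lambda>z. cosh_sqrt (- z * of_real t ^ 2)) has_field_derivative
      sinhc_sqrt (- z * of_real t ^ 2) / 2 * (- (of_real t ^ 2))) (at z)"
    by (rule DERIV_chain2[OF DERIV_cosh_sqrt]) (auto intro!: derivative_eq_intros)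
  then show ?thesis
    by (simp add: cosz_def[abs_def] sinz_def power2_eq_square mult_ac)
qed

lemma sinz_DERIV_z:
  "((\<lambda>z. sinz z t) has_field_derivative sinz_dz z t) (at z)"
proof -
  have "((\<lambda>z. of_real t * sinhc_sqrt (- z * of_real t ^ 2)) has_field_derivative
      of_real t * (deriv sinhc_sqrt (- z * of_real t ^ 2) * (- (of_real t ^ 2)))) (at z)"
    by (rule DERIV_cmult, rule DERIV_chain2[OF DERIV_sinhc_sqrt]) (auto intro!: derivative_eq_intros)
  then show ?thesis
    by (simp add: sinz_def[abs_def] sinz_dz_def power2_eq_square power3_eq_cube mult_ac)
qed

lemma cosz_cosh: "cosz (- (k\<^sup>2)) t = cosh (k * of_real t)"
  by (simp add: cosz_def power_mult_distrib[symmetric] cosh_sqrt_square)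

lemma sinz_sinh: "k * sinz (- (k\<^sup>2)) t = sinh (k * of_real t)"
  using sinhc_sqrt_square[of "k * of_real t"]
  by (simp add: sinz_def power_mult_distrib[symmetric] mult_ac)

lemma cosz_sinz_wronskian: "cosz z t * cosz z t + z * sinz z t * sinz z t = 1"
proof -
  define k where "k = csqrt (- z)"
  have z: "z = - (k\<^sup>2)" by (simp add: k_def)
  have "cosz z t * cosz z t + z * sinz z t * sinz z t = (cosz z t)\<^sup>2 - (k * sinz z t)\<^sup>2"
    by (simp add: z power2_eq_square)
  also have "\<dots> = 1"
    unfolding z cosz_cosh sinz_sinh by (simp add: cosh_square_eq)
  finally show ?thesis .
qed

definition edge_sol :: "complex \<Rightarrow> complex \<Rightarrow> complex \<Rightarrow> real \<Rightarrow> complex" where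
  "edge_sol z a b t = a * cosz z t + b * sinz z t"

definition edge_sol_deriv :: "complex \<Rightarrow> complex \<Rightarrow> complex \<Rightarrow> real \<Rightarrow> complex" where
  "edge_sol_deriv z a b t = b * cosz z t - a * z * sinz z t"

lemma edge_sol_vector_derivative:
  "(edge_sol z a b has_vector_derivative edge_sol_deriv z a b t) (at t within S)"
  unfolding edge_sol_def[abs_def] edge_sol_deriv_def
  by (rule derivative_eq_intros cosz_vector_derivative sinz_vector_derivative refl | simp add: algebra_simps)+

lemma edge_sol_deriv_vector_derivative:
  "(edge_sol_deriv z a b has_vector_derivative - z * edge_sol z a b t) (at t within S)"
  unfolding edge_sol_def edge_sol_deriv_def[abs_def]
  by (rule derivative_eq_intros cosz_vector_derivative sinz_vector_derivative refl | simp add: algebra_simps)+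

definition edge_sol_dz :: "complex \<Rightarrow> complex \<Rightarrow> complex \<Rightarrow> real \<Rightarrow> complex" where
  "edge_sol_dz z a b t = a * (- (of_real t / 2) * sinz z t) + b * sinz_dz z t"

definition edge_sol_deriv_dz :: "complex \<Rightarrow> complex \<Rightarrow> complex \<Rightarrow> real \<Rightarrow> complex" where
  "edge_sol_deriv_dz z a b t =
     b * (- (of_real t / 2) * sinz z t) - a * (sinz z t + z * sinz_dz z t)"

lemma edge_sol_DERIV_z:
  "((\<lambda>z. edge_sol z a b t) has_field_derivative edge_sol_dz z a b t) (at z)"
  unfolding edge_sol_def[abs_def] edge_sol_dz_def
  by (rule derivative_eq_intros cosz_DERIV_z sinz_DERIV_z refl | simp)+

lemma edge_sol_deriv_DERIV_z:
  "((\<lambda>z. edge_sol_deriv z a b t) has_field_derivative edge_sol_deriv_dz z a b t) (at z)"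
  unfolding edge_sol_deriv_def[abs_def] edge_sol_deriv_dz_def
  by (rule derivative_eq_intros cosz_DERIV_z sinz_DERIV_z refl | simp add: algebra_simps)+

lemma cosz_eq_sinz_dz: "z * sinz_dz z t * 2 = of_real t * cosz z t - sinz z t"
proof -
  have "z * sinz_dz z t * 2 = of_real t * (2 * (- z * of_real t ^ 2) * deriv sinhc_sqrt (- z * of_real t ^ 2))"
    by (simp add: sinz_dz_def power2_eq_square power3_eq_cube)
  also have "\<dots> = of_real t * cosz z t - sinz z t"
    unfolding sinhc_sqrt_times_deriv by (simp add: cosz_def sinz_def algebra_simps)
  finally show ?thesis .
qed

lemma edge_sol_dz_vector_derivative:
  "(edge_sol_dz z a b has_vector_derivative edge_sol_deriv_dz z a b t) (at t within S)"
proof -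
  have "(edge_sol_dz z a b has_vector_derivative 
     a * (- (1 / 2) * sinz z t + - (of_real t / 2) * cosz z t) + b * (- (of_real t / 2) * sinz z t)) (at t within S)"
    unfolding edge_sol_dz_def[abs_def]
    by (rule derivative_eq_intros sinz_vector_derivative sinz_dz_vector_derivative
        has_vector_derivative_of_real refl | simp)+
  also have "a * (- (1 / 2) * sinz z t + - (of_real t / 2) * cosz z t) + b * (- (of_real t / 2) * sinz z t)
      = edge_sol_deriv_dz z a b t"
  proof -
    have eq: "- (1 / 2) * sinz z t + - (of_real t / 2) * cosz z t = - (sinz z t + z * sinz_dz z t)"
      using cosz_eq_sinz_dz[of z t] by (simp add: field_simps)
    show ?thesis unfolding edge_sol_deriv_dz_def eq by (simp add: algebra_simps)
  qed
  finally show ?thesis .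
qed

text \<open>
  The derivative in \<open>z\<close> of the equation \<open>f'' = -z f\<close>.  The inhomogeneous term \<open>-f\<close> is what makes the
  boundary form of \<open>edge_green_dz\<close> an energy, up to its sign.
\<close>

lemma edge_sol_deriv_dz_vector_derivative:
  "(edge_sol_deriv_dz z a b has_vector_derivative
      - z * edge_sol_dz z a b t - edge_sol z a b t) (at t within S)"
proof -
  have "(edge_sol_deriv_dz z a b has_vector_derivative
    b * (- (1 / 2) * sinz z t + - (of_real t / 2) * cosz z t)
     - a * (cosz z t + z * (- (of_real t / 2) * sinz z t))) (at t within S)"
    unfolding edge_sol_deriv_dz_def[abs_def]
    by (rule derivative_eq_intros sinz_vector_derivative sinz_dz_vector_derivative
        has_vector_derivative_of_real refl | simp)+
  also have "b * (- (1 / 2) * sinz z t + - (of_real t / 2) * cosz z t)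
     - a * (cosz z t + z * (- (of_real t / 2) * sinz z t))
     = - z * edge_sol_dz z a b t - edge_sol z a b t"
  proof -
    have eq: "- (1 / 2) * sinz z t + - (of_real t / 2) * cosz z t = - (sinz z t + z * sinz_dz z t)"
      using cosz_eq_sinz_dz[of z t] by (simp add: field_simps)
    show ?thesis unfolding edge_sol_dz_def edge_sol_def eq by (simp add: algebra_simps)
  qed
  finally show ?thesis .
qed

text \<open>
  The Wronskians of \<open>f\<close> with the two basis solutions are constant, and \<open>f\<close> is recovered from them because
  the Wronskian of the basis solutions themselves is \<open>1\<close>.
\<close>

lemma edge_sol_unique:
  assumes "l > 0"
    and f: "\<And>t. t \<in> {0..l} \<Longrightarrow> (f has_vector_derivative f' t) (at t within {0..l})"
    and f': "\<And>t. t \<in> {0..l} \<Longrightarrow> (f' has_vector_derivative - z * f t) (at t within {0..l})"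
    and t: "t \<in> {0..l}"
  shows "f t = edge_sol z (f 0) (f' 0) t"
proof -
  define p where "p t = f t * cosz z t - f' t * sinz z t" for t
  define q where "q t = f t * (z * sinz z t) + f' t * cosz z t" for t
  have "(p has_vector_derivative 0) (at t within {0..l})" if "t \<in> {0..l}" for t
    unfolding p_def[abs_def]
    by (rule derivative_eq_intros f f' that cosz_vector_derivative sinz_vector_derivative refl
        | simp add: algebra_simps)+
  then obtain c where "\<And>t. t \<in> {0..l} \<Longrightarrow> p t = c"
    using has_vector_derivative_zero_constant[of "{0..l}" p] by auto
  then have p: "p t = f 0" using t by (force simp: p_def)
  have "(q has_vector_derivative 0) (at t within {0..l})" if "t \<in> {0..l}" for t
    unfolding q_def[abs_def]
    by (rule derivative_eq_intros f f' that cosz_vector_derivative sinz_vector_derivative refl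
        | simp add: algebra_simps)+
  then obtain c where "\<And>t. t \<in> {0..l} \<Longrightarrow> q t = c"
    using has_vector_derivative_zero_constant[of "{0..l}" q] by auto
  then have q: "q t = f' 0" using t by (force simp: q_def)
  have "edge_sol z (f 0) (f' 0) t = f t * (cosz z t * cosz z t + z * sinz z t * sinz z t)"
    unfolding edge_sol_def p[symmetric] q[symmetric] by (simp add: p_def q_def algebra_simps)
  then show ?thesis by (simp add: cosz_sinz_wronskian)
qed

lemma edge_sol_norm_integral_eq_0:
  assumes l: "l > 0" and "integral {0..l} (\<lambda>t. (cmod (edge_sol z a b t))\<^sup>2) = 0"
  shows "a = 0" "b = 0"
proof -
  have cont: "continuous_on {0..l} (edge_sol z a b)"
    by (rule continuous_on_vector_derivative) (rule edge_sol_vector_derivative)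
  have "continuous_on {0..l} (\<lambda>t. (cmod (edge_sol z a b t))\<^sup>2)"
    by (intro continuous_intros cont)
  from integral_eq_0_iff[OF this] assms
  have zero: "edge_sol z a b t = 0" if "t \<in> {0..l}" for t
    using that by simp
  show "a = 0" using zero[of 0] l by (simp add: edge_sol_def)
  have "(edge_sol z a b has_vector_derivative 0) (at 0 within {0..l})"
    by (rule has_vector_derivative_transform[OF _ zero has_vector_derivative_const]) (use l in auto)
  then have "edge_sol_deriv z a b 0 = 0"
    using l edge_sol_vector_derivative[of z a b 0 "{0..l}"]
      vector_derivative_unique_within_closed_interval[of 0 l 0 "edge_sol z a b" 0] by auto
  then show "b = 0" by (simp add: edge_sol_deriv_def)
qed

section \<open>Green's identity on an edge\<close>

text \<open>
  The integrand is the derivative of \<open>f' * cnj g - f * cnj g'\<close>.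
\<close>

lemma edge_green:
  assumes "0 \<le> l"
    and f: "\<And>t. (f has_vector_derivative f' t) (at t within {0..l})"
    and f': "\<And>t. (f' has_vector_derivative f'' t) (at t within {0..l})"
    and g: "\<And>t. (g has_vector_derivative g' t) (at t within {0..l})"
    and g': "\<And>t. (g' has_vector_derivative g'' t) (at t within {0..l})"
  shows "((\<lambda>t. f'' t * cnj (g t) - f t * cnj (g'' t)) has_integral
      (f' l * cnj (g l) - f l * cnj (g' l)) - (f' 0 * cnj (g 0) - f 0 * cnj (g' 0))) {0..l}"
proof (rule fundamental_theorem_of_calculus[OF assms(1)])
  have c: "((\<lambda>t. cnj (h t)) has_vector_derivative cnj h') (at t within {0..l})"
    if "(h has_vector_derivative h') (at t within {0..l})" for h h' t
    using that by (rule bounded_linear.has_vector_derivative[OF bounded_linear_cnj])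
  fix t assume "t \<in> {0..l}"
  show "((\<lambda>t. f' t * cnj (g t) - f t * cnj (g' t)) has_vector_derivative
      f'' t * cnj (g t) - f t * cnj (g'' t)) (at t within {0..l})"
    by (rule derivative_eq_intros f f' c[OF g] c[OF g'] refl | simp add: algebra_simps)+
qed

definition edge_energy :: "complex \<Rightarrow> complex \<Rightarrow> complex \<Rightarrow> real \<Rightarrow> real" where
  "edge_energy z a b l = integral {0..l} (\<lambda>t. (cmod (edge_sol z a b t))\<^sup>2)"

lemma edge_energy_has_integral:
  "((\<lambda>t. c * (edge_sol z a b t * cnj (edge_sol z a b t))) has_integral c * of_real (edge_energy z a b l)) {0..l}"
proof -
  have "continuous_on {0..l} (edge_sol z a b)"
    by (rule continuous_on_vector_derivative) (rule edge_sol_vector_derivative)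
  then have "(\<lambda>t. (cmod (edge_sol z a b t))\<^sup>2) integrable_on {0..l}"
    by (intro integrable_continuous_real continuous_intros)
  then have "((\<lambda>t. (cmod (edge_sol z a b t))\<^sup>2) has_integral edge_energy z a b l) {0..l}"
    unfolding edge_energy_def by (rule integrable_integral)
  from has_integral_mult_right[OF has_integral_of_real[OF this, where 'b = complex], of c]
  show ?thesis by (simp only: complex_norm_square)
qed

lemma edge_energy_nonneg: "edge_energy z a b l \<ge> 0"
  unfolding edge_energy_def by (cases "(\<lambda>t. (cmod (edge_sol z a b t))\<^sup>2) integrable_on {0..l}")
    (auto intro: integral_nonneg simp: not_integrable_integral)

text \<open>
  Green's identity for a solution and itself.  For nonreal \<open>z\<close> the boundary form controls the energy.
\<close>

lemma edge_green_self:
  assumes "0 \<le> l"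
  shows "(edge_sol_deriv z a b l * cnj (edge_sol z a b l) - edge_sol z a b l * cnj (edge_sol_deriv z a b l))
       - (edge_sol_deriv z a b 0 * cnj (edge_sol z a b 0) - edge_sol z a b 0 * cnj (edge_sol_deriv z a b 0))
     = (cnj z - z) * of_real (edge_energy z a b l)"
proof (rule has_integral_unique)
  show "((\<lambda>t. - z * edge_sol z a b t * cnj (edge_sol z a b t) - edge_sol z a b t * cnj (- z * edge_sol z a b t))
      has_integral
       (edge_sol_deriv z a b l * cnj (edge_sol z a b l) - edge_sol z a b l * cnj (edge_sol_deriv z a b l))
       - (edge_sol_deriv z a b 0 * cnj (edge_sol z a b 0) - edge_sol z a b 0 * cnj (edge_sol_deriv z a b 0)))
      {0..l}"
    by (rule edge_green[OF assms]) (rule edge_sol_vector_derivative edge_sol_deriv_vector_derivative)+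
  show "((\<lambda>t. - z * edge_sol z a b t * cnj (edge_sol z a b t) - edge_sol z a b t * cnj (- z * edge_sol z a b t))
      has_integral (cnj z - z) * of_real (edge_energy z a b l)) {0..l}"
    using edge_energy_has_integral[of "cnj z - z" z a b l] by (simp add: algebra_simps)
qed

text \<open>
  Green's identity for a solution \<open>g\<close> at real \<open>z\<close> and a function \<open>f\<close> with \<open>f'' + z f = -g\<close>, which is the
  general form of the \<open>z\<close>-derivative of a family of solutions passing through \<open>g\<close>.
\<close>

lemma edge_green_dz:
  fixes a b c d :: complex
  assumes "0 \<le> l" "cnj z = z"
  defines "f \<equiv> \<lambda>t. edge_sol_dz z a b t + edge_sol z c d t"
    and "f' \<equiv> \<lambda>t. edge_sol_deriv_dz z a b t + edge_sol_deriv z c d t"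
  shows "(f' l * cnj (edge_sol z a b l) - f l * cnj (edge_sol_deriv z a b l))
       - (f' 0 * cnj (edge_sol z a b 0) - f 0 * cnj (edge_sol_deriv z a b 0))
     = - of_real (edge_energy z a b l)"
proof (rule has_integral_unique)
  let ?F = "\<lambda>t. (- z * edge_sol_dz z a b t - edge_sol z a b t + - z * edge_sol z c d t)
      * cnj (edge_sol z a b t) - f t * cnj (- z * edge_sol z a b t)"
  show "(?F has_integral
       (f' l * cnj (edge_sol z a b l) - f l * cnj (edge_sol_deriv z a b l))
       - (f' 0 * cnj (edge_sol z a b 0) - f 0 * cnj (edge_sol_deriv z a b 0)))
      {0..l}"
    unfolding f_def f'_def
    by (rule edge_green[OF assms(1)])
      (rule has_vector_derivative_add edge_sol_vector_derivative edge_sol_deriv_vector_derivative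
        edge_sol_dz_vector_derivative edge_sol_deriv_dz_vector_derivative)+
  have "?F = (\<lambda>t. - 1 * (edge_sol z a b t * cnj (edge_sol z a b t)))"
    by (simp add: fun_eq_iff f_def assms(2) algebra_simps)
  then show "(?F has_integral - of_real (edge_energy z a b l)) {0..l}"
    using edge_energy_has_integral[of "- 1" z a b l] by simp
qed

section \<open>Vertex conditions and the secular determinant\<close>

definition linear_functional :: "((nat \<Rightarrow> complex) \<Rightarrow> complex) \<Rightarrow> bool" where
  "linear_functional L \<longleftrightarrow>
     (\<forall>a v b w. L (\<lambda>k. a * v k + b * w k) = a * L v + b * L w)"

lemma linear_functional_sum:
  assumes "linear_functional L"
  shows "L (\<lambda>k. \<Sum>i\<in>I. y i * V i k) = (\<Sum>i\<in>I. y i * L (V i))"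
proof -
  have add: "L (\<lambda>k. a * v k + b * w k) = a * L v + b * L w" for a v b w
    using assms by (auto simp: linear_functional_def)
  have "L (\<lambda>k. 0) = 0" using add[of 0 _ 0] by simp
  then show ?thesis
  proof (induction I rule: infinite_finite_induct)
    case (insert i I)
    then show ?case using add[of "y i" "V i" 1 "\<lambda>k. \<Sum>i\<in>I. y i * V i k"] by simp
  qed simp_all
qed

definition unit_coeff :: "nat \<Rightarrow> nat \<Rightarrow> complex" where
  "unit_coeff i k = (if k = i then 1 else 0)"

lemma linear_functional_expand:
  assumes "linear_functional L" "finite I"
    and "\<And>v w. (\<And>k. k \<in> I \<Longrightarrow> v k = w k) \<Longrightarrow> L v = L w"
  shows "L v = (\<Sum>i\<in>I. L (unit_coeff i) * v i)"
proof -
  have "L v = L (\<lambda>k. \<Sum>i\<in>I. v i * unit_coeff i k)"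
    using assms(2) by (intro assms(3)) (simp add: unit_coeff_def if_distrib[of "(*) _"] cong: if_cong)
  then show ?thesis
    by (simp add: linear_functional_sum[OF assms(1)] mult.commute)
qed

lemma sum_over_edge_ends:
  fixes g :: "nat \<Rightarrow> 'a::comm_monoid_add"
  shows "(\<Sum>k\<in>{1..2 * n}. g k) = (\<Sum>j\<in>{1..n}. g (2 * j - 1) + g (2 * j))"
  by (induction n) (simp_all add: add.assoc)

locale metric_graph =
  fixes G :: marked_graph
  assumes marked_graph: "is_marked_graph G"
begin

abbreviation "num_ends \<equiv> 2 * num_edges G"

definition vertex_of :: "nat \<Rightarrow> nat" where
  "vertex_of k = (THE m. m \<in> {1..num_vertices G} \<and> k \<in> vertex G m)"

text \<open>
  Each vertex yields as many linear conditions as it has endpoints.  The chosen endpoint carries the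
  condition with the coupling constant, each other endpoint the condition that the value or normal
  derivative there equals the one at the chosen endpoint.
\<close>

definition vertex_rep :: "nat \<Rightarrow> nat" where
  "vertex_rep m = Min (vertex G m)"

lemma vertex_subset: "m \<in> {1..num_vertices G} \<Longrightarrow> vertex G m \<subseteq> {1..num_ends}"
  using marked_graph unfolding is_marked_graph_def partition_on_def by blast

lemma vertex_finite: "m \<in> {1..num_vertices G} \<Longrightarrow> finite (vertex G m)"
  using vertex_subset finite_subset by blast

lemma vertex_nonempty: "m \<in> {1..num_vertices G} \<Longrightarrow> vertex G m \<noteq> {}"
  using marked_graph unfolding is_marked_graph_def partition_on_def by (metis image_eqI)

lemma vertex_disjoint:
  assumes "m \<in> {1..num_vertices G}" "m' \<in> {1..num_vertices G}" "k \<in> vertex G m" "k \<in> vertex G m'"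
  shows "m = m'"
proof -
  have d: "disjoint (vertex G ` {1..num_vertices G})" and i: "inj_on (vertex G) {1..num_vertices G}"
    using marked_graph unfolding is_marked_graph_def partition_on_def by blast+
  have "vertex G m = vertex G m'"
    using disjointD[OF d imageI[OF assms(1)] imageI[OF assms(2)]] assms(3,4) by blast
  then show ?thesis using inj_onD[OF i _ assms(1,2)] by blast
qed

lemma vertex_of_eq: "m \<in> {1..num_vertices G} \<Longrightarrow> k \<in> vertex G m \<Longrightarrow> vertex_of k = m"
  unfolding vertex_of_def using vertex_disjoint by (intro the_equality) auto

lemma vertex_of:
  assumes "k \<in> {1..num_ends}"
  shows "vertex_of k \<in> {1..num_vertices G}" "k \<in> vertex G (vertex_of k)"
proof -
  have "k \<in> \<Union> (vertex G ` {1..num_vertices G})"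
    using assms marked_graph unfolding is_marked_graph_def partition_on_def by blast
  then obtain m where m: "m \<in> {1..num_vertices G}" "k \<in> vertex G m" by blast
  then show "vertex_of k \<in> {1..num_vertices G}" "k \<in> vertex G (vertex_of k)"
    using vertex_of_eq[OF m] by auto
qed

lemma vertex_rep:
  assumes "m \<in> {1..num_vertices G}"
  shows "vertex_rep m \<in> vertex G m" "vertex_rep m \<in> {1..num_ends}" "vertex_of (vertex_rep m) = m"
proof -
  show *: "vertex_rep m \<in> vertex G m"
    unfolding vertex_rep_def using assms vertex_finite vertex_nonempty by simp
  show "vertex_rep m \<in> {1..num_ends}" using * vertex_subset assms by blast
  show "vertex_of (vertex_rep m) = m" using vertex_of_eq[OF assms *] .
qed

lemma valence_pos: "m \<in> {1..num_vertices G} \<Longrightarrow> valence G m > 0"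
  unfolding valence_def using vertex_finite vertex_nonempty by (simp add: card_gt_0_iff)

lemma sum_over_vertices:
  "(\<Sum>k\<in>{1..num_ends}. g k) = (\<Sum>m\<in>{1..num_vertices G}. \<Sum>k\<in>vertex G m. g k)"
proof -
  have "{1..num_ends} = (\<Union>m\<in>{1..num_vertices G}. vertex G m)"
    using vertex_subset vertex_of by blast
  moreover have "vertex G i \<inter> vertex G j = {}"
    if "i \<in> {1..num_vertices G}" "j \<in> {1..num_vertices G}" "i \<noteq> j" for i j
    using vertex_disjoint[OF that(1,2)] that(3) by blast
  ultimately show ?thesis
    using vertex_finite by (simp only:) (rule sum.UNION_disjoint, simp_all)
qed

text \<open>
  The arguments \<open>u\<close> and \<open>u'\<close> are the values and the normal derivatives at all endpoints.  The rotation
  \<open>(u, u') \<mapsto> (u', -u)\<close> turns the conditions of a \<open>\<delta>'\<close> vertex into those of a \<open>\<delta>\<close> vertex with the same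
  coupling constant, and it preserves the boundary form \<open>u' * cnj w - u * cnj w'\<close>.  So both
  types are treated alike: the continuous data agree at all endpoints of a vertex, and the sum of the
  balanced data is \<open>\<alpha>/\<gamma>\<close> times the sum of the continuous data.
\<close>

definition continuous_data :: "nat \<Rightarrow> (nat \<Rightarrow> complex) \<Rightarrow> (nat \<Rightarrow> complex) \<Rightarrow> nat \<Rightarrow> complex" where
  "continuous_data m u u' k = (case vertex_mark G m of Delta \<Rightarrow> u k | Delta_prime \<Rightarrow> u' k)"

definition balanced_data :: "nat \<Rightarrow> (nat \<Rightarrow> complex) \<Rightarrow> (nat \<Rightarrow> complex) \<Rightarrow> nat \<Rightarrow> complex" where
  "balanced_data m u u' k = (case vertex_mark G m of Delta \<Rightarrow> u' k | Delta_prime \<Rightarrow> - u k)"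

definition coupling_row ::
    "(nat \<Rightarrow> real) \<Rightarrow> nat \<Rightarrow> (nat \<Rightarrow> complex) \<Rightarrow> (nat \<Rightarrow> complex) \<Rightarrow> complex" where
  "coupling_row \<alpha> r u u' =
     (let m = vertex_of r in
      if r = vertex_rep m then
        (\<Sum>k\<in>vertex G m. balanced_data m u u' k)
          - of_real (\<alpha> m / real (valence G m)) * (\<Sum>k\<in>vertex G m. continuous_data m u u' k)
      else continuous_data m u u' r - continuous_data m u u' (vertex_rep m))"

lemma coupling_row_linear:
  "coupling_row \<alpha> r (\<lambda>k. a * u k + b * w k) (\<lambda>k. a * u' k + b * w' k)
     = a * coupling_row \<alpha> r u u' + b * coupling_row \<alpha> r w w'"
  by (cases "vertex_mark G (vertex_of r)")
    (simp_all add: coupling_row_def Let_def continuous_data_def balanced_data_def sum.distrib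
      sum_distrib_left sum_negf algebra_simps sum_subtractf)

lemma coupling_row_cong:
  assumes "r \<in> {1..num_ends}"
    and "\<And>k. k \<in> {1..num_ends} \<Longrightarrow> u k = w k" "\<And>k. k \<in> {1..num_ends} \<Longrightarrow> u' k = w' k"
  shows "coupling_row \<alpha> r u u' = coupling_row \<alpha> r w w'"
proof -
  note m = vertex_of(1)[OF assms(1)]
  have *: "continuous_data (vertex_of r) u u' k = continuous_data (vertex_of r) w w' k"
    "balanced_data (vertex_of r) u u' k = balanced_data (vertex_of r) w w' k"
    if "k \<in> {1..num_ends}" for k
    using assms(2,3)[OF that] by (auto simp: continuous_data_def balanced_data_def split: vertex_type.split)
  have "sum (continuous_data (vertex_of r) u u') (vertex G (vertex_of r))
      = sum (continuous_data (vertex_of r) w w') (vertex G (vertex_of r))"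
    "sum (balanced_data (vertex_of r) u u') (vertex G (vertex_of r))
      = sum (balanced_data (vertex_of r) w w') (vertex G (vertex_of r))"
    using * vertex_subset[OF m] by (auto intro!: sum.cong)
  then show ?thesis
    unfolding coupling_row_def Let_def using *[OF assms(1)] *[OF vertex_rep(2)[OF m]] by simp
qed

lemma coupling_row_derivative:
  assumes "\<And>k. ((\<lambda>z. u z k) has_field_derivative U k) (at z)"
    and "\<And>k. ((\<lambda>z. u' z k) has_field_derivative U' k) (at z)"
  shows "((\<lambda>z. coupling_row \<alpha> r (u z) (u' z)) has_field_derivative coupling_row \<alpha> r U U') (at z)"
  by (cases "vertex_mark G (vertex_of r)")
    (auto simp: coupling_row_def Let_def continuous_data_def balanced_data_def
      intro!: DERIV_cdivide DERIV_cmult DERIV_sum DERIV_diff DERIV_minus assms)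

lemma coupling_rows_eq_0_iff:
  "(\<forall>r\<in>{1..num_ends}. coupling_row \<alpha> r u u' = 0) \<longleftrightarrow>
   (\<forall>m\<in>{1..num_vertices G}.
      (\<forall>i\<in>vertex G m. \<forall>j\<in>vertex G m. continuous_data m u u' i = continuous_data m u u' j) \<and>
      (\<Sum>k\<in>vertex G m. balanced_data m u u' k)
        = of_real (\<alpha> m / real (valence G m)) * (\<Sum>k\<in>vertex G m. continuous_data m u u' k))"
    (is "?L \<longleftrightarrow> ?R")
proof
  assume L: ?L
  show ?R
  proof
    fix m assume m: "m \<in> {1..num_vertices G}"
    have "continuous_data m u u' i = continuous_data m u u' (vertex_rep m)" if "i \<in> vertex G m" for i
    proof (cases "i = vertex_rep m")
      case False
      have "coupling_row \<alpha> i u u' = 0" using L vertex_subset[OF m] that by blast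
      then show ?thesis
        using vertex_of_eq[OF m that] False by (simp add: coupling_row_def Let_def)
    qed simp
    moreover have "coupling_row \<alpha> (vertex_rep m) u u' = 0" using L vertex_rep[OF m] by blast
    ultimately show "(\<forall>i\<in>vertex G m. \<forall>j\<in>vertex G m. continuous_data m u u' i = continuous_data m u u' j) \<and>
      (\<Sum>k\<in>vertex G m. balanced_data m u u' k)
        = of_real (\<alpha> m / real (valence G m)) * (\<Sum>k\<in>vertex G m. continuous_data m u u' k)"
      using vertex_rep(3)[OF m] by (simp add: coupling_row_def Let_def)
  qed
next
  assume R: ?R
  show ?L
  proof
    fix r assume r: "r \<in> {1..num_ends}"
    note Rm = bspec[OF R vertex_of(1)[OF r]]
    have "continuous_data (vertex_of r) u u' r = continuous_data (vertex_of r) u u' (vertex_rep (vertex_of r))"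
      using Rm vertex_of(2)[OF r] vertex_rep(1)[OF vertex_of(1)[OF r]] by blast
    then show "coupling_row \<alpha> r u u' = 0"
      using conjunct2[OF Rm] by (simp add: coupling_row_def Let_def)
  qed
qed

text \<open>
  This is the symmetry of the Laplacian.  At a vertex with continuous data \<open>c\<close> and \<open>d\<close> the balanced data
  sum to \<open>\<alpha> c\<close> and \<open>\<alpha> d\<close>, so the boundary form is \<open>\<alpha> c * cnj d - c * cnj (\<alpha> d)\<close>, which vanishes
  because \<open>\<alpha>\<close> is real.
\<close>

lemma coupling_rows_lagrangian:
  assumes u: "\<forall>r\<in>{1..num_ends}. coupling_row \<alpha> r u u' = 0"
    and w: "\<forall>r\<in>{1..num_ends}. coupling_row \<alpha> r w w' = 0"
  shows "(\<Sum>k\<in>{1..num_ends}. u' k * cnj (w k) - u k * cnj (w' k)) = 0"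
  unfolding sum_over_vertices
proof (rule sum.neutral, rule ballI)
  fix m assume m: "m \<in> {1..num_vertices G}"
  let ?p = "continuous_data m u u'" and ?q = "balanced_data m u u'"
  let ?P = "continuous_data m w w'" and ?Q = "balanced_data m w w'"
  let ?a = "of_real (\<alpha> m / real (valence G m)) :: complex"
  define c where "c = ?p (vertex_rep m)"
  define d where "d = ?P (vertex_rep m)"
  have p: "?p k = c" "?P k = d" if "k \<in> vertex G m" for k
    using bspec[OF u[unfolded coupling_rows_eq_0_iff] m] bspec[OF w[unfolded coupling_rows_eq_0_iff] m]
      that vertex_rep(1)[OF m] unfolding c_def d_def by blast+
  have q: "sum ?q (vertex G m) = ?a * sum ?p (vertex G m)" "sum ?Q (vertex G m) = ?a * sum ?P (vertex G m)"
    using bspec[OF u[unfolded coupling_rows_eq_0_iff] m] bspec[OF w[unfolded coupling_rows_eq_0_iff] m]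
    by blast+
  have "(\<Sum>k\<in>vertex G m. u' k * cnj (w k) - u k * cnj (w' k))
      = (\<Sum>k\<in>vertex G m. ?q k * cnj (?P k) - ?p k * cnj (?Q k))"
    by (intro sum.cong) (auto simp: continuous_data_def balanced_data_def split: vertex_type.split)
  also have "\<dots> = (\<Sum>k\<in>vertex G m. ?q k * cnj d - c * cnj (?Q k))"
    by (intro sum.cong) (auto simp: p)
  also have "\<dots> = sum ?q (vertex G m) * cnj d - c * cnj (sum ?Q (vertex G m))"
    by (simp add: sum_subtractf sum_distrib_left sum_distrib_right)
  also have "\<dots> = 0"
    unfolding q by (simp add: p)
  finally show "(\<Sum>k\<in>vertex G m. u' k * cnj (w k) - u k * cnj (w' k)) = 0" .
qed

definition end_offset :: "nat \<Rightarrow> real" where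
  "end_offset k = endpoint G k - endpoint G (2 * endpoint_edge k - 1)"

text \<open>
  Derivatives are taken in the direction into the edge.
\<close>

definition end_sign :: "nat \<Rightarrow> complex" where
  "end_sign k = (if odd k then 1 else -1)"

text \<open>
  The coefficients of edge \<open>j\<close> are stored at the two indices \<open>2j - 1\<close> and \<open>2j\<close> of its endpoints, so that
  a solution on all edges is given by one vector with the index set of the endpoints.
\<close>

definition edge_trace ::
    "(complex \<Rightarrow> complex \<Rightarrow> real \<Rightarrow> complex) \<Rightarrow> (nat \<Rightarrow> complex) \<Rightarrow> nat \<Rightarrow> complex" where
  "edge_trace F v k = F (v (2 * endpoint_edge k - 1)) (v (2 * endpoint_edge k)) (end_offset k)"

definition secular_row :: "(nat \<Rightarrow> real) \<Rightarrow> complex \<Rightarrow> nat \<Rightarrow> (nat \<Rightarrow> complex) \<Rightarrow> complex" where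
  "secular_row \<alpha> z r v = coupling_row \<alpha> r (edge_trace (edge_sol z) v)
     (\<lambda>k. end_sign k * edge_trace (edge_sol_deriv z) v k)"

definition secular_row_dz :: "(nat \<Rightarrow> real) \<Rightarrow> complex \<Rightarrow> nat \<Rightarrow> (nat \<Rightarrow> complex) \<Rightarrow> complex" where
  "secular_row_dz \<alpha> z r v = coupling_row \<alpha> r (edge_trace (edge_sol_dz z) v)
     (\<lambda>k. end_sign k * edge_trace (edge_sol_deriv_dz z) v k)"

definition secular_det :: "(nat \<Rightarrow> real) \<Rightarrow> complex \<Rightarrow> complex" where
  "secular_det \<alpha> z = square_det num_ends (\<lambda>r i. secular_row \<alpha> z r (unit_coeff i))"

lemma endpoint_edge_bounds:
  assumes "k \<in> {1..num_ends}"
  shows "endpoint_edge k \<in> {1..num_edges G}"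
    "2 * endpoint_edge k - 1 \<in> {1..num_ends}" "2 * endpoint_edge k \<in> {1..num_ends}"
  using assms unfolding endpoint_edge_def atLeastAtMost_iff by presburger+

lemma endpoint_edge_simps [simp]:
  "1 \<le> j \<Longrightarrow> endpoint_edge (2 * j - 1) = j" "endpoint_edge (2 * j) = j"
  by (auto simp: endpoint_edge_def)

lemma edge_length_pos: "j \<in> {1..num_edges G} \<Longrightarrow> end_offset (2 * j) > 0"
  using marked_graph by (auto simp: end_offset_def is_marked_graph_def)

lemma end_offset_left: "1 \<le> j \<Longrightarrow> end_offset (2 * j - 1) = 0"
  unfolding end_offset_def endpoint_edge_simps(1) by simp

lemma linear_secular_row: "linear_functional (secular_row \<alpha> z r)"
proof -
  have "edge_trace (edge_sol z) (\<lambda>k. a * v k + b * w k)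
      = (\<lambda>k. a * edge_trace (edge_sol z) v k + b * edge_trace (edge_sol z) w k)" for a b v w
    by (simp add: edge_trace_def fun_eq_iff edge_sol_def algebra_simps)
  moreover have "(\<lambda>k. end_sign k * edge_trace (edge_sol_deriv z) (\<lambda>k. a * v k + b * w k) k)
      = (\<lambda>k. a * (end_sign k * edge_trace (edge_sol_deriv z) v k)
           + b * (end_sign k * edge_trace (edge_sol_deriv z) w k))" for a b v w
    by (simp add: edge_trace_def fun_eq_iff edge_sol_deriv_def algebra_simps)
  ultimately show ?thesis
    by (simp add: linear_functional_def secular_row_def coupling_row_linear)
qed

lemma secular_row_cong:
  assumes "r \<in> {1..num_ends}" "\<And>k. k \<in> {1..num_ends} \<Longrightarrow> v k = w k"
  shows "secular_row \<alpha> z r v = secular_row \<alpha> z r w"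
  unfolding secular_row_def
  using assms endpoint_edge_bounds by (intro coupling_row_cong) (auto simp: edge_trace_def)

lemma secular_row_expand:
  assumes "r \<in> {1..num_ends}"
  shows "secular_row \<alpha> z r v = (\<Sum>i\<in>{1..num_ends}. secular_row \<alpha> z r (unit_coeff i) * v i)"
  by (rule linear_functional_expand[OF linear_secular_row]) (auto intro!: secular_row_cong[OF assms])

lemma secular_row_DERIV:
  "((\<lambda>z. secular_row \<alpha> z r v) has_field_derivative secular_row_dz \<alpha> z r v) (at z)"
  unfolding secular_row_def[abs_def] secular_row_dz_def edge_trace_def
  by (intro coupling_row_derivative DERIV_cmult edge_sol_DERIV_z edge_sol_deriv_DERIV_z)

lemma holomorphic_secular_row: "(\<lambda>z. secular_row \<alpha> z r v) holomorphic_on S"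
  unfolding holomorphic_on_def field_differentiable_def
  using secular_row_DERIV has_field_derivative_at_within by blast

lemma holomorphic_secular_det: "secular_det \<alpha> holomorphic_on S"
  unfolding secular_det_def[abs_def]
  by (intro holomorphic_square_det holomorphic_secular_row)

lemma secular_det_eq_0_iff:
  "secular_det \<alpha> z = 0 \<longleftrightarrow>
     (\<exists>v. (\<exists>i\<in>{1..num_ends}. v i \<noteq> 0) \<and> (\<forall>r\<in>{1..num_ends}. secular_row \<alpha> z r v = 0))"
  unfolding secular_det_def square_det_eq_0_iff using secular_row_expand by simp

text \<open>
  All energies are nonnegative, and an edge with zero energy has zero coefficients.
\<close>

lemma coefficients_eq_0:
  assumes "(\<Sum>j\<in>{1..num_edges G}. edge_energy z (v (2 * j - 1)) (v (2 * j)) (end_offset (2 * j))) = 0"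
    and i: "i \<in> {1..num_ends}"
  shows "v i = 0"
proof -
  define j where "j = endpoint_edge i"
  have j: "j \<in> {1..num_edges G}" using endpoint_edge_bounds(1)[OF i] by (simp add: j_def)
  have "edge_energy z (v (2 * j - 1)) (v (2 * j)) (end_offset (2 * j)) = 0"
    using assms(1) j edge_energy_nonneg by (subst (asm) sum_nonneg_eq_0_iff) auto
  from edge_sol_norm_integral_eq_0[OF edge_length_pos[OF j] this[unfolded edge_energy_def]]
  have "v (2 * j - 1) = 0" "v (2 * j) = 0" by auto
  moreover have "i = 2 * j - 1 \<or> i = 2 * j"
    using i unfolding j_def endpoint_edge_def atLeastAtMost_iff by presburger
  ultimately show ?thesis by auto
qed

text \<open>
  The sign in the normal derivative at the right endpoint turns the sum over the endpoints into the sum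
  over the edges of the differences that occur in Green's identity.
\<close>

lemma boundary_form_edges:
  "(\<Sum>k\<in>{1..num_ends}. end_sign k * edge_trace F' v k * cnj (edge_trace H w k)
       - edge_trace F v k * cnj (end_sign k * edge_trace H' w k))
   = - (\<Sum>j\<in>{1..num_edges G}.
      (F' (v (2*j-1)) (v (2*j)) (end_offset (2*j)) * cnj (H (w (2*j-1)) (w (2*j)) (end_offset (2*j)))
         - F (v (2*j-1)) (v (2*j)) (end_offset (2*j)) * cnj (H' (w (2*j-1)) (w (2*j)) (end_offset (2*j))))
    - (F' (v (2*j-1)) (v (2*j)) 0 * cnj (H (w (2*j-1)) (w (2*j)) 0)
         - F (v (2*j-1)) (v (2*j)) 0 * cnj (H' (w (2*j-1)) (w (2*j)) 0)))"
  unfolding sum_over_edge_ends sum_negf[symmetric]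
proof (rule sum.cong)
  fix j assume "j \<in> {1..num_edges G}"
  then have j: "1 \<le> j" by simp
  show "end_sign (2*j-1) * edge_trace F' v (2*j-1) * cnj (edge_trace H w (2*j-1))
       - edge_trace F v (2*j-1) * cnj (end_sign (2*j-1) * edge_trace H' w (2*j-1))
      + (end_sign (2*j) * edge_trace F' v (2*j) * cnj (edge_trace H w (2*j))
       - edge_trace F v (2*j) * cnj (end_sign (2*j) * edge_trace H' w (2*j)))
    = - (
      (F' (v (2*j-1)) (v (2*j)) (end_offset (2*j)) * cnj (H (w (2*j-1)) (w (2*j)) (end_offset (2*j)))
         - F (v (2*j-1)) (v (2*j)) (end_offset (2*j)) * cnj (H' (w (2*j-1)) (w (2*j)) (end_offset (2*j))))
    - (F' (v (2*j-1)) (v (2*j)) 0 * cnj (H (w (2*j-1)) (w (2*j)) 0)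
         - F (v (2*j-1)) (v (2*j)) 0 * cnj (H' (w (2*j-1)) (w (2*j)) 0)))"
    using j unfolding edge_trace_def endpoint_edge_simps(1)[OF j] endpoint_edge_simps(2)
      end_offset_left[OF j] by (simp add: end_sign_def)
qed simp

text \<open>
  By Green's identity the total energy times \<open>cnj z - z\<close> is the boundary form, which vanishes.
\<close>

lemma secular_kernel_trivial:
  assumes "Im z \<noteq> 0" and v: "\<forall>r\<in>{1..num_ends}. secular_row \<alpha> z r v = 0"
    and i: "i \<in> {1..num_ends}"
  shows "v i = 0"
proof (rule coefficients_eq_0[OF _ i])
  let ?E = "\<lambda>j. edge_energy z (v (2 * j - 1)) (v (2 * j)) (end_offset (2 * j))"
  have len: "0 \<le> end_offset (2 * j)" if "j \<in> {1..num_edges G}" for j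
    using edge_length_pos[OF that] by simp
  note lagr = coupling_rows_lagrangian[OF v[unfolded secular_row_def] v[unfolded secular_row_def]]
  \<comment> \<open>the boundary form vanishes, and it is minus the sum of Green's identities over the edges\<close>
  have "- (\<Sum>j\<in>{1..num_edges G}. (cnj z - z) * of_real (?E j)) = 0"
    unfolding lagr[symmetric] boundary_form_edges
    by (intro arg_cong[where f = uminus] sum.cong refl edge_green_self[symmetric] len)
  then have "(\<Sum>j\<in>{1..num_edges G}. (cnj z - z) * of_real (?E j)) = 0" by simp
  then have "(cnj z - z) * of_real (\<Sum>j\<in>{1..num_edges G}. ?E j) = 0"
    by (simp only: sum_distrib_left of_real_sum)
  moreover have "cnj z - z \<noteq> 0" using assms(1) by (auto simp: complex_eq_iff)
  ultimately show "(\<Sum>j\<in>{1..num_edges G}. ?E j) = 0"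
    by (simp only: mult_eq_0_iff of_real_eq_0_iff simp_thms)
qed

text \<open>
  If \<open>g\<close> is the eigenfunction with coefficients \<open>v\<close>, then the hypothesis on \<open>w\<close> says that some \<open>f\<close>
  satisfying the vertex conditions solves \<open>-f'' - z f = g\<close>.  By symmetry \<open>g\<close> is then orthogonal to itself.
  In other words, a selfadjoint operator has no generalised eigenvectors beyond its eigenvectors.
\<close>

lemma secular_kernel_transversal:
  assumes "Im z = 0" and v: "\<forall>r\<in>{1..num_ends}. secular_row \<alpha> z r v = 0"
    and w: "\<forall>r\<in>{1..num_ends}. secular_row_dz \<alpha> z r v + secular_row \<alpha> z r w = 0"
    and i: "i \<in> {1..num_ends}"
  shows "v i = 0"
proof (rule coefficients_eq_0[OF _ i])
  let ?E = "\<lambda>j. edge_energy z (v (2 * j - 1)) (v (2 * j)) (end_offset (2 * j))"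
  let ?u = "\<lambda>k. edge_trace (edge_sol_dz z) v k + edge_trace (edge_sol z) w k"
  let ?u' = "\<lambda>k. end_sign k * (edge_trace (edge_sol_deriv_dz z) v k + edge_trace (edge_sol_deriv z) w k)"
  have z: "cnj z = z" using assms(1) by (simp add: complex_eq_iff)
  have "coupling_row \<alpha> r ?u ?u' = 0" if "r \<in> {1..num_ends}" for r
    using w that coupling_row_linear[of \<alpha> r 1 "edge_trace (edge_sol_dz z) v" 1 "edge_trace (edge_sol z) w"
       "\<lambda>k. end_sign k * edge_trace (edge_sol_deriv_dz z) v k" "\<lambda>k. end_sign k * edge_trace (edge_sol_deriv z) w k"]
    by (simp add: secular_row_def secular_row_dz_def algebra_simps)
  then have u: "\<forall>r\<in>{1..num_ends}. coupling_row \<alpha> r ?u ?u' = 0" by blast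
  have "0 = (\<Sum>k\<in>{1..num_ends}. ?u' k * cnj (edge_trace (edge_sol z) v k)
       - ?u k * cnj (end_sign k * edge_trace (edge_sol_deriv z) v k))"
    using coupling_rows_lagrangian[OF u v[unfolded secular_row_def]] by simp
  also have "\<dots> = (\<Sum>k\<in>{1..num_ends}.
         end_sign k * edge_trace (edge_sol_deriv_dz z) v k * cnj (edge_trace (edge_sol z) v k)
       - edge_trace (edge_sol_dz z) v k * cnj (end_sign k * edge_trace (edge_sol_deriv z) v k))
     + (\<Sum>k\<in>{1..num_ends}.
         end_sign k * edge_trace (edge_sol_deriv z) w k * cnj (edge_trace (edge_sol z) v k)
       - edge_trace (edge_sol z) w k * cnj (end_sign k * edge_trace (edge_sol_deriv z) v k))"
    by (simp add: sum.distrib[symmetric] algebra_simps)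
  also have "\<dots> = - (\<Sum>j\<in>{1..num_edges G}. - of_real (?E j))"
    unfolding boundary_form_edges minus_add_distrib[symmetric] sum.distrib[symmetric]
  proof (intro arg_cong[where f = uminus] sum.cong refl)
    fix j assume "j \<in> {1..num_edges G}"
    from edge_length_pos[OF this] have "0 \<le> end_offset (2 * j)" by simp
    note edge_green_dz[OF this z, of "v (2 * j - 1)" "v (2 * j)" "w (2 * j - 1)" "w (2 * j)", symmetric]
    then show "edge_sol_deriv_dz z (v (2 * j - 1)) (v (2 * j)) (end_offset (2 * j)) *
          cnj (edge_sol z (v (2 * j - 1)) (v (2 * j)) (end_offset (2 * j))) -
          edge_sol_dz z (v (2 * j - 1)) (v (2 * j)) (end_offset (2 * j)) *
          cnj (edge_sol_deriv z (v (2 * j - 1)) (v (2 * j)) (end_offset (2 * j))) -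
          (edge_sol_deriv_dz z (v (2 * j - 1)) (v (2 * j)) 0 * cnj (edge_sol z (v (2 * j - 1)) (v (2 * j)) 0) -
           edge_sol_dz z (v (2 * j - 1)) (v (2 * j)) 0 * cnj (edge_sol_deriv z (v (2 * j - 1)) (v (2 * j)) 0)) +
          (edge_sol_deriv z (w (2 * j - 1)) (w (2 * j)) (end_offset (2 * j)) *
           cnj (edge_sol z (v (2 * j - 1)) (v (2 * j)) (end_offset (2 * j))) -
           edge_sol z (w (2 * j - 1)) (w (2 * j)) (end_offset (2 * j)) *
           cnj (edge_sol_deriv z (v (2 * j - 1)) (v (2 * j)) (end_offset (2 * j))) -
           (edge_sol_deriv z (w (2 * j - 1)) (w (2 * j)) 0 * cnj (edge_sol z (v (2 * j - 1)) (v (2 * j)) 0) -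
            edge_sol z (w (2 * j - 1)) (w (2 * j)) 0 * cnj (edge_sol_deriv z (v (2 * j - 1)) (v (2 * j)) 0)))
        = - of_real (?E j)"
      by (simp only: ring_distribs) (simp only: algebra_simps)
  qed
  finally have "complex_of_real (\<Sum>j\<in>{1..num_edges G}. ?E j) = 0" by (simp add: sum_negf)
  then show "(\<Sum>j\<in>{1..num_edges G}. ?E j) = 0" by (simp only: of_real_eq_0_iff)
qed

lemma secular_det_nonreal: "Im z \<noteq> 0 \<Longrightarrow> secular_det \<alpha> z \<noteq> 0"
  unfolding secular_det_eq_0_iff using secular_kernel_trivial by blast

end

section \<open>Eigenspaces and the secular matrix\<close>

lemma continuous_imp_L2_interval:
  assumes "continuous_on {a..b} h"
  shows "h \<in> L2_interval a b"
proof -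
  have "set_integrable lebesgue {a..b} h"
    by (rule absolutely_integrable_continuous_real[OF assms])
  then have "set_borel_measurable lebesgue {a..b} h"
    unfolding set_integrable_def set_borel_measurable_def by (rule borel_measurable_integrable)
  moreover have "set_integrable lebesgue {a..b} (\<lambda>t. (norm (h t))\<^sup>2)"
    by (rule absolutely_integrable_continuous_real) (intro continuous_intros assms)
  ultimately show ?thesis by (simp add: L2_interval_def)
qed

text \<open>
  For continuous \<open>h\<close> the weak formulation is the classical one, by the fundamental theorem of
  calculus in both directions.
\<close>

lemma has_second_derivative_L2_continuous_iff:
  assumes h: "continuous_on {a..b} h"
  shows "has_second_derivative_L2 f h a b \<longleftrightarrow>
    (\<exists>f'. \<forall>t\<in>{a..b}. (f has_vector_derivative f' t) (at t within {a..b}) \<and>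
                    (f' has_vector_derivative h t) (at t within {a..b}))"
proof -
  have int: "(LINT s:{a..t}|lebesgue. h s) = integral {a..t} h" if "t \<in> {a..b}" for t
    using continuous_on_subset[OF h, of "{a..t}"] that
    by (intro set_lebesgue_integral_eq_integral absolutely_integrable_continuous_real) auto
  have "(\<forall>t\<in>{a..b}. f' t = f' a + integral {a..t} h) \<longleftrightarrow>
      (\<forall>t\<in>{a..b}. (f' has_vector_derivative h t) (at t within {a..b}))" for f' :: "real \<Rightarrow> complex"
  proof
    assume f': "\<forall>t\<in>{a..b}. f' t = f' a + integral {a..t} h"
    show "\<forall>t\<in>{a..b}. (f' has_vector_derivative h t) (at t within {a..b})"
    proof
      fix t assume t: "t \<in> {a..b}"
      have "((\<lambda>t. f' a + integral {a..t} h) has_vector_derivative 0 + h t) (at t within {a..b})"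
        by (intro has_vector_derivative_add has_vector_derivative_const integral_has_vector_derivative h t)
      from has_vector_derivative_transform[OF t bspec[OF f'] this]
      show "(f' has_vector_derivative h t) (at t within {a..b})" by simp
    qed
  next
    assume f': "\<forall>t\<in>{a..b}. (f' has_vector_derivative h t) (at t within {a..b})"
    show "\<forall>t\<in>{a..b}. f' t = f' a + integral {a..t} h"
    proof
      fix t assume t: "t \<in> {a..b}"
      have "(h has_integral (f' t - f' a)) {a..t}"
      proof (rule fundamental_theorem_of_calculus)
        show "a \<le> t" using t by simp
        fix x assume "x \<in> {a..t}"
        then have "x \<in> {a..b}" using t by auto
        from has_vector_derivative_within_subset[OF bspec[OF f' this], of "{a..t}"] t
        show "(f' has_vector_derivative h x) (at x within {a..t})" by simp
      qed
      then show "f' t = f' a + integral {a..t} h" by (simp add: integral_unique)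
    qed
  qed
  then show ?thesis
    unfolding has_second_derivative_L2_def using continuous_imp_L2_interval[OF h] int
    by (simp add: ball_conj_distrib)
qed

context metric_graph
begin

text \<open>
  At a vertex of valence \<open>1\<close> the agreement of the data at all its endpoints is automatic.
\<close>

lemma vertex_conditions_iff:
  "(\<forall>m\<in>{1..num_vertices G}. internal G m \<longrightarrow>
      (case vertex_mark G m of
         Delta \<Rightarrow> \<forall>i\<in>vertex G m. \<forall>j\<in>vertex G m. end_value G f i = end_value G f j
       | Delta_prime \<Rightarrow>
           \<forall>i\<in>vertex G m. \<forall>j\<in>vertex G m. normal_deriv G f i = normal_deriv G f j)) \<and>
   (\<forall>m\<in>{1..num_vertices G}.
      (case vertex_mark G m of
         Delta \<Rightarrow>
           vertex_normal_sum G f m = of_real (\<alpha> m / real (valence G m)) * vertex_sum G f m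
       | Delta_prime \<Rightarrow>
           vertex_sum G f m = - of_real (\<alpha> m / real (valence G m)) * vertex_normal_sum G f m)) \<longleftrightarrow>
   (\<forall>r\<in>{1..num_ends}. coupling_row \<alpha> r (end_value G f) (normal_deriv G f) = 0)"
  unfolding coupling_rows_eq_0_iff ball_conj_distrib[symmetric]
proof (rule ball_cong[OF refl])
  fix m assume m: "m \<in> {1..num_vertices G}"
  have single: "i = j" if "\<not> internal G m" "i \<in> vertex G m" "j \<in> vertex G m" for i j
  proof -
    have "card (vertex G m) = 1"
      using that(1) valence_pos[OF m] by (simp add: internal_def valence_def)
    then show ?thesis using that(2,3) by (auto simp: card_1_singleton_iff)
  qed
  let ?C = "\<lambda>c :: nat \<Rightarrow> complex. \<forall>i\<in>vertex G m. \<forall>j\<in>vertex G m. c i = c j"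
  have C: "(internal G m \<longrightarrow> ?C c) \<longleftrightarrow> ?C c" for c using single by blast
  have flip: "x = - a * y \<longleftrightarrow> - x = a * y" for x a y :: complex
    by (metis minus_minus mult_minus_left)
  show "(internal G m \<longrightarrow>
      (case vertex_mark G m of
         Delta \<Rightarrow> \<forall>i\<in>vertex G m. \<forall>j\<in>vertex G m. end_value G f i = end_value G f j
       | Delta_prime \<Rightarrow>
           \<forall>i\<in>vertex G m. \<forall>j\<in>vertex G m. normal_deriv G f i = normal_deriv G f j)) \<and>
      (case vertex_mark G m of
         Delta \<Rightarrow>
           vertex_normal_sum G f m = of_real (\<alpha> m / real (valence G m)) * vertex_sum G f m
       | Delta_prime \<Rightarrow>
           vertex_sum G f m = - of_real (\<alpha> m / real (valence G m)) * vertex_normal_sum G f m) \<longleftrightarrow>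
      (\<forall>i\<in>vertex G m. \<forall>j\<in>vertex G m.
          continuous_data m (end_value G f) (normal_deriv G f) i
          = continuous_data m (end_value G f) (normal_deriv G f) j) \<and>
      (\<Sum>k\<in>vertex G m. balanced_data m (end_value G f) (normal_deriv G f) k)
        = of_real (\<alpha> m / real (valence G m))
          * (\<Sum>k\<in>vertex G m. continuous_data m (end_value G f) (normal_deriv G f) k)"
  proof (cases "vertex_mark G m")
    case Delta
    then show ?thesis
      unfolding continuous_data_def balanced_data_def vertex_sum_def vertex_normal_sum_def
      by (simp only: vertex_type.case C)
  next
    case Delta_prime
    then show ?thesis
      unfolding continuous_data_def balanced_data_def vertex_sum_def vertex_normal_sum_def
      by (simp only: vertex_type.case C sum_negf flip)
  qed
qed

definition graph_sol :: "complex \<Rightarrow> (nat \<Rightarrow> complex) \<Rightarrow> nat \<Rightarrow> real \<Rightarrow> complex" where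
  "graph_sol z v j t = (if j \<in> {1..num_edges G} \<and> t \<in> edge G j
     then edge_sol z (v (2 * j - 1)) (v (2 * j)) (t - endpoint G (2 * j - 1)) else 0)"

lemma edge_ends_less: "j \<in> {1..num_edges G} \<Longrightarrow> endpoint G (2 * j - 1) < endpoint G (2 * j)"
  using marked_graph by (simp add: is_marked_graph_def)

lemma endpoint_in_edge:
  assumes "k \<in> {1..num_ends}"
  shows "endpoint G k \<in> edge G (endpoint_edge k)"
proof -
  have "k = 2 * endpoint_edge k - 1 \<or> k = 2 * endpoint_edge k"
    using assms unfolding endpoint_edge_def atLeastAtMost_iff by presburger
  then show ?thesis
    using edge_ends_less[OF endpoint_edge_bounds(1)[OF assms]] unfolding edge_def by force
qed

lemma graph_sol_vector_derivative:
  assumes "j \<in> {1..num_edges G}" "t \<in> edge G j"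
  shows "(graph_sol z v j has_vector_derivative
      edge_sol_deriv z (v (2 * j - 1)) (v (2 * j)) (t - endpoint G (2 * j - 1))) (at t within edge G j)"
proof -
  let ?c = "endpoint G (2 * j - 1)"
  have "((\<lambda>t. t - ?c) has_vector_derivative 1) (at t within edge G j)"
    by (auto intro!: derivative_eq_intros)
  from vector_diff_chain_within[OF this edge_sol_vector_derivative[of z "v (2 * j - 1)" "v (2 * j)"]]
  have "((\<lambda>t. edge_sol z (v (2 * j - 1)) (v (2 * j)) (t - ?c)) has_vector_derivative
      edge_sol_deriv z (v (2 * j - 1)) (v (2 * j)) (t - ?c)) (at t within edge G j)"
    by (simp add: o_def)
  then show ?thesis
    using assms by (subst has_vector_derivative_transform[OF assms(2)]) (auto simp: graph_sol_def)
qed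

lemma graph_sol_deriv_vector_derivative:
  assumes "j \<in> {1..num_edges G}" "t \<in> edge G j"
  shows "((\<lambda>t. edge_sol_deriv z (v (2 * j - 1)) (v (2 * j)) (t - endpoint G (2 * j - 1)))
      has_vector_derivative - z * graph_sol z v j t) (at t within edge G j)"
proof -
  let ?c = "endpoint G (2 * j - 1)"
  have "((\<lambda>t. t - ?c) has_vector_derivative 1) (at t within edge G j)"
    by (auto intro!: derivative_eq_intros)
  from vector_diff_chain_within[OF this edge_sol_deriv_vector_derivative[of z "v (2 * j - 1)" "v (2 * j)"]]
  show ?thesis using assms by (simp add: o_def graph_sol_def)
qed

lemma graph_sol_end_value:
  assumes "k \<in> {1..num_ends}"
  shows "end_value G (graph_sol z v) k = edge_trace (edge_sol z) v k"
  using endpoint_in_edge[OF assms] endpoint_edge_bounds(1)[OF assms]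
  by (simp add: end_value_def graph_sol_def edge_trace_def end_offset_def)

lemma graph_sol_normal_deriv:
  assumes "k \<in> {1..num_ends}"
  shows "normal_deriv G (graph_sol z v) k = end_sign k * edge_trace (edge_sol_deriv z) v k"
proof -
  let ?j = "endpoint_edge k"
  note j = endpoint_edge_bounds(1)[OF assms] and e = endpoint_in_edge[OF assms]
  have "vector_derivative (graph_sol z v ?j) (at (endpoint G k) within edge G ?j)
     = edge_sol_deriv z (v (2 * ?j - 1)) (v (2 * ?j)) (endpoint G k - endpoint G (2 * ?j - 1))"
    using edge_ends_less[OF j] e graph_sol_vector_derivative[OF j e, of z v]
    unfolding edge_def by (intro vector_derivative_within_cbox[unfolded box_real]) auto
  then show ?thesis
    by (simp add: normal_deriv_def end_sign_def edge_trace_def end_offset_def)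
qed

lemma graph_sol_secular_row:
  assumes "r \<in> {1..num_ends}"
  shows "coupling_row \<alpha> r (end_value G (graph_sol z v)) (normal_deriv G (graph_sol z v))
     = secular_row \<alpha> z r v"
  unfolding secular_row_def
  by (rule coupling_row_cong[OF assms]) (simp_all only: graph_sol_end_value graph_sol_normal_deriv)

text \<open>
  Eigenfunctions are continuous, hence their weak second derivative is a classical one.
\<close>

lemma eigenspace_iff:
  "f \<in> eigenspace (laplacian G \<alpha>) z \<longleftrightarrow>
     supported_on_graph G f \<and>
     (\<forall>j\<in>{1..num_edges G}. \<exists>f'. \<forall>t\<in>edge G j.
        (f j has_vector_derivative f' t) (at t within edge G j) \<and>
        (f' has_vector_derivative - z * f j t) (at t within edge G j)) \<and>
     (\<forall>r\<in>{1..num_ends}. coupling_row \<alpha> r (end_value G f) (normal_deriv G f) = 0)"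
    (is "?L \<longleftrightarrow> ?S \<and> ?D \<and> ?V")
proof
  assume L: ?L
  then have lap: "(f, graph_scale z f) \<in> laplacian G \<alpha>" by (simp add: eigenspace_def)
  then have dom: "f \<in> graph_domain G" "f \<in> W22 G" and S: ?S
    by (auto simp: laplacian_def laplacian_domain_def graph_domain_def W22_def)
  have V: ?V
    unfolding vertex_conditions_iff[symmetric] using lap
    by (simp add: laplacian_def laplacian_domain_def graph_domain_def)
  have ?D
  proof
    fix j assume j: "j \<in> {1..num_edges G}"
    have sd: "has_second_derivative_L2 (f j) (\<lambda>t. - z * f j t) (endpoint G (2 * j - 1)) (endpoint G (2 * j))"
      using lap j by (simp add: laplacian_def graph_scale_def)
    then have "continuous_on (edge G j) (f j)"
      unfolding has_second_derivative_L2_def edge_def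
      by (meson continuous_on_vector_derivative)
    then have "continuous_on (edge G j) (\<lambda>t. - z * f j t)" by (intro continuous_intros)
    with sd show "\<exists>f'. \<forall>t\<in>edge G j.
        (f j has_vector_derivative f' t) (at t within edge G j) \<and>
        (f' has_vector_derivative - z * f j t) (at t within edge G j)"
      unfolding edge_def by (simp only: has_second_derivative_L2_continuous_iff)
  qed
  with S V show "?S \<and> ?D \<and> ?V" by blast
next
  assume R: "?S \<and> ?D \<and> ?V"
  have cont: "continuous_on (edge G j) (f j)" if "j \<in> {1..num_edges G}" for j
    using R that by (meson continuous_on_vector_derivative)
  have sd: "has_second_derivative_L2 (f j) (\<lambda>t. - z * f j t) (endpoint G (2 * j - 1)) (endpoint G (2 * j))"
    if j: "j \<in> {1..num_edges G}" for j
  proof -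
    have "continuous_on (edge G j) (\<lambda>t. - z * f j t)" by (intro continuous_intros cont j)
    then show ?thesis
      using R j unfolding edge_def by (simp only: has_second_derivative_L2_continuous_iff)
  qed
  then have W: "f \<in> W22 G" using R unfolding W22_def by blast
  have "f \<in> laplacian_domain G \<alpha>"
    using R W unfolding vertex_conditions_iff[symmetric]
    by (simp add: laplacian_domain_def graph_domain_def)
  moreover have "graph_scale z f \<in> L2_graph G"
  proof -
    have "(\<lambda>t. z * f j t) \<in> L2_interval (endpoint G (2 * j - 1)) (endpoint G (2 * j))"
      if "j \<in> {1..num_edges G}" for j
      using cont[OF that] by (intro continuous_imp_L2_interval continuous_intros) (simp add: edge_def)
    then show ?thesis
      using R by (auto simp: L2_graph_def supported_on_graph_def graph_scale_def)
  qed
  ultimately show ?L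
    using sd by (simp add: eigenspace_def laplacian_def graph_scale_def)
qed

text \<open>
  The coefficients of an eigenfunction on an edge are its value and derivative at the left endpoint.
\<close>

proposition eigenspace_eq_secular_kernel:
  "eigenspace (laplacian G \<alpha>) z
     = graph_sol z ` {v. \<forall>r\<in>{1..num_ends}. secular_row \<alpha> z r v = 0}"
proof (intro equalityI subsetI)
  fix f assume f: "f \<in> eigenspace (laplacian G \<alpha>) z"
  have "\<forall>j\<in>{1..num_edges G}. \<exists>f'. \<forall>t\<in>edge G j.
        (f j has_vector_derivative f' t) (at t within edge G j) \<and>
        (f' has_vector_derivative - z * f j t) (at t within edge G j)"
    using f unfolding eigenspace_iff by blast
  then obtain f' where f': "\<And>j t. j \<in> {1..num_edges G} \<Longrightarrow> t \<in> edge G j \<Longrightarrow>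
        (f j has_vector_derivative f' j t) (at t within edge G j)"
      "\<And>j t. j \<in> {1..num_edges G} \<Longrightarrow> t \<in> edge G j \<Longrightarrow>
        (f' j has_vector_derivative - z * f j t) (at t within edge G j)"
    by metis
  define v where "v k = (if odd k then f (endpoint_edge k) (endpoint G k)
      else f' (endpoint_edge k) (endpoint G (k - 1)))" for k
  have "f j t = graph_sol z v j t" for j t
  proof (cases "j \<in> {1..num_edges G} \<and> t \<in> edge G j")
    case True
    then have j: "j \<in> {1..num_edges G}" and t: "t \<in> edge G j" by auto
    let ?a = "endpoint G (2 * j - 1)" and ?b = "endpoint G (2 * j)"
    have img: "(\<lambda>s. s + ?a) ` {0..?b - ?a} = edge G j"
      by (simp add: edge_def)
    have mem: "s + ?a \<in> edge G j" if "s \<in> {0..?b - ?a}" for s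
      using that by (auto simp: edge_def)
    have shift: "((\<lambda>s. s + ?a) has_vector_derivative 1) (at s within {0..?b - ?a})" for s
      by (auto intro!: derivative_eq_intros)
    have "f j ((t - ?a) + ?a) = edge_sol z (f j (0 + ?a)) (f' j (0 + ?a)) (t - ?a)"
    proof (rule edge_sol_unique[where f = "\<lambda>s. f j (s + ?a)" and f' = "\<lambda>s. f' j (s + ?a)"])
      show "0 < ?b - ?a" using edge_ends_less[OF j] by simp
      show "t - ?a \<in> {0..?b - ?a}" using t by (auto simp: edge_def)
      fix s assume s: "s \<in> {0..?b - ?a}"
      show "((\<lambda>s. f j (s + ?a)) has_vector_derivative f' j (s + ?a)) (at s within {0..?b - ?a})"
        using vector_diff_chain_within[OF shift, unfolded img, OF f'(1)[OF j mem[OF s]]]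
        by (simp add: o_def)
      show "((\<lambda>s. f' j (s + ?a)) has_vector_derivative - z * f j (s + ?a)) (at s within {0..?b - ?a})"
        using vector_diff_chain_within[OF shift, unfolded img, OF f'(2)[OF j mem[OF s]]]
        by (simp add: o_def)
    qed
    moreover have "v (2 * j - 1) = f j ?a" "v (2 * j) = f' j ?a"
      using j by (auto simp: v_def endpoint_edge_def)
    ultimately show ?thesis using True by (simp add: graph_sol_def)
  next
    case False
    then show ?thesis
      using f unfolding eigenspace_iff supported_on_graph_def graph_sol_def by auto
  qed
  then have fv: "f = graph_sol z v" by (simp add: fun_eq_iff)
  show "f \<in> graph_sol z ` {v. \<forall>r\<in>{1..num_ends}. secular_row \<alpha> z r v = 0}"
    using f unfolding fv eigenspace_iff by (auto simp: graph_sol_secular_row simp del: atLeastAtMost_iff)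
next
  fix f assume "f \<in> graph_sol z ` {v. \<forall>r\<in>{1..num_ends}. secular_row \<alpha> z r v = 0}"
  then obtain v where f: "f = graph_sol z v"
    and v: "\<forall>r\<in>{1..num_ends}. secular_row \<alpha> z r v = 0" by blast
  show "f \<in> eigenspace (laplacian G \<alpha>) z"
    unfolding eigenspace_iff f
  proof (intro conjI ballI)
    show "supported_on_graph G (graph_sol z v)"
      by (auto simp: supported_on_graph_def graph_sol_def)
    fix j assume "j \<in> {1..num_edges G}"
    then show "\<exists>f'. \<forall>t\<in>edge G j.
        (graph_sol z v j has_vector_derivative f' t) (at t within edge G j) \<and>
        (f' has_vector_derivative - z * graph_sol z v j t) (at t within edge G j)"
      by (intro exI[of _ "\<lambda>t. edge_sol_deriv z (v (2 * j - 1)) (v (2 * j)) (t - endpoint G (2 * j - 1))"]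
          ballI conjI graph_sol_vector_derivative graph_sol_deriv_vector_derivative)
  qed (use v graph_sol_secular_row in auto)
qed

lemma graph_sol_linear:
  "graph_sol z (\<lambda>k. \<Sum>i\<in>I. y i * V i k) = (\<Sum>i\<in>I. graph_scale (y i) (graph_sol z (V i)))"
proof -
  have eval: "(\<Sum>i\<in>I. F i) j t = (\<Sum>i\<in>I. F i j t)" for F :: "'a \<Rightarrow> nat \<Rightarrow> real \<Rightarrow> complex" and j t
    by (induction I rule: infinite_finite_induct) auto
  show ?thesis
    by (auto simp: fun_eq_iff eval graph_scale_def graph_sol_def edge_sol_def sum_distrib_right
        sum_distrib_left sum.distrib[symmetric] algebra_simps)
qed

lemma graph_sol_eq_0_iff: "graph_sol z v = 0 \<longleftrightarrow> (\<forall>i\<in>{1..num_ends}. v i = 0)"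
proof
  assume "graph_sol z v = 0"
  then have eq: "graph_sol z v = graph_sol z (\<lambda>_. 0)"
    by (auto simp: fun_eq_iff graph_sol_def edge_sol_def)
  show "\<forall>i\<in>{1..num_ends}. v i = 0"
  proof
    fix i assume i: "i \<in> {1..num_ends}"
    let ?j = "endpoint_edge i"
    note j = endpoint_edge_bounds[OF i]
    then have j1: "1 \<le> ?j" by simp
    have "edge_trace (edge_sol z) v (2 * ?j - 1) = edge_trace (edge_sol z) (\<lambda>_. 0) (2 * ?j - 1)"
      using eq graph_sol_end_value[OF j(2)] by metis
    then have 1: "v (2 * ?j - 1) = 0"
      unfolding edge_trace_def endpoint_edge_simps(1)[OF j1] end_offset_left[OF j1]
      by (simp add: edge_sol_def)
    have "end_sign (2 * ?j - 1) * edge_trace (edge_sol_deriv z) v (2 * ?j - 1)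
        = end_sign (2 * ?j - 1) * edge_trace (edge_sol_deriv z) (\<lambda>_. 0) (2 * ?j - 1)"
      using eq graph_sol_normal_deriv[OF j(2)] by metis
    then have 2: "v (2 * ?j) = 0"
      unfolding edge_trace_def endpoint_edge_simps(1)[OF j1] end_offset_left[OF j1]
      by (simp add: edge_sol_deriv_def end_sign_def split: if_splits)
    have "i = 2 * ?j - 1 \<or> i = 2 * ?j"
      using i unfolding endpoint_edge_def atLeastAtMost_iff by presburger
    then show "v i = 0" using 1 2 by auto
  qed
next
  assume v: "\<forall>i\<in>{1..num_ends}. v i = 0"
  have "v (2 * j - 1) = 0" "v (2 * j) = 0" if "j \<in> {1..num_edges G}" for j
    using that by (auto intro!: bspec[OF v])
  then show "graph_sol z v = 0"
    by (auto simp: fun_eq_iff graph_sol_def edge_sol_def)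
qed

end

section \<open>The order of the zeros of the secular determinant\<close>

lemma graph_fun_independent_family:
  assumes "bij_betw b I B" "finite I" "graph_fun.independent B"
    and "(\<Sum>i\<in>I. graph_scale (c i) (b i)) = 0" "i \<in> I"
  shows "c i = 0"
proof -
  let ?inv = "the_inv_into I b"
  have inj: "inj_on b I" and B: "B = b ` I" using assms(1) by (auto simp: bij_betw_def)
  have "(\<Sum>x\<in>B. graph_scale (c (?inv x)) x) = (\<Sum>i\<in>I. graph_scale (c i) (b i))"
    unfolding B by (subst sum.reindex[OF inj]) (auto intro!: sum.cong simp: the_inv_into_f_f[OF inj])
  then have sum0: "(\<Sum>x\<in>B. graph_scale (c (?inv x)) x) = 0" using assms(4) by simp
  have fin: "finite B" using B assms(2) by simp
  have "c (?inv x) = 0" if "x \<in> B" for x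
  proof (rule ccontr)
    assume "c (?inv x) \<noteq> 0"
    then have "graph_fun.dependent B"
      unfolding graph_fun.dependent_finite[OF fin]
      using sum0 that by (intro exI[of _ "\<lambda>x. c (?inv x)"] conjI bexI[of _ x])
    then show False using assms(3) by contradiction
  qed
  moreover have "b i \<in> B" using B assms(5) by blast
  ultimately have "c (?inv (b i)) = 0" by blast
  then show ?thesis by (simp only: the_inv_into_f_f[OF inj assms(5)])
qed

context metric_graph
begin

lemma graph_sol_cong:
  assumes "\<And>k. k \<in> {1..num_ends} \<Longrightarrow> v k = w k"
  shows "graph_sol z v = graph_sol z w"
proof -
  have "v (2 * j - 1) = w (2 * j - 1)" "v (2 * j) = w (2 * j)" if "j \<in> {1..num_edges G}" for j
    using that by (auto intro!: assms)
  then show ?thesis by (auto simp: fun_eq_iff graph_sol_def)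
qed

lemma graph_sol_in_eigenspace_iff:
  "graph_sol z v \<in> eigenspace (laplacian G \<alpha>) z \<longleftrightarrow> (\<forall>r\<in>{1..num_ends}. secular_row \<alpha> z r v = 0)"
proof
  assume "graph_sol z v \<in> eigenspace (laplacian G \<alpha>) z"
  then show "\<forall>r\<in>{1..num_ends}. secular_row \<alpha> z r v = 0"
    unfolding eigenspace_iff using graph_sol_secular_row by metis
qed (auto simp: eigenspace_eq_secular_kernel)

lemma linear_secular_row_dz: "linear_functional (secular_row_dz \<alpha> z r)"
proof -
  have "edge_trace (edge_sol_dz z) (\<lambda>k. a * v k + b * w k)
      = (\<lambda>k. a * edge_trace (edge_sol_dz z) v k + b * edge_trace (edge_sol_dz z) w k)" for a b v w
    by (simp add: edge_trace_def fun_eq_iff edge_sol_dz_def algebra_simps)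
  moreover have "(\<lambda>k. end_sign k * edge_trace (edge_sol_deriv_dz z) (\<lambda>k. a * v k + b * w k) k)
      = (\<lambda>k. a * (end_sign k * edge_trace (edge_sol_deriv_dz z) v k)
           + b * (end_sign k * edge_trace (edge_sol_deriv_dz z) w k))" for a b v w
    by (simp add: edge_trace_def fun_eq_iff edge_sol_deriv_dz_def algebra_simps)
  ultimately show ?thesis
    by (simp add: linear_functional_def secular_row_dz_def coupling_row_linear)
qed

lemma secular_row_dz_cong:
  assumes "r \<in> {1..num_ends}" "\<And>k. k \<in> {1..num_ends} \<Longrightarrow> v k = w k"
  shows "secular_row_dz \<alpha> z r v = secular_row_dz \<alpha> z r w"
  unfolding secular_row_dz_def
  using assms endpoint_edge_bounds by (intro coupling_row_cong) (auto simp: edge_trace_def)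

lemma secular_row_dz_zero:
  assumes "r \<in> {1..num_ends}" "\<And>k. k \<in> {1..num_ends} \<Longrightarrow> v k = 0"
  shows "secular_row_dz \<alpha> z r v = 0"
proof -
  have "secular_row_dz \<alpha> z r v = secular_row_dz \<alpha> z r (\<lambda>k. 0)"
    using assms by (intro secular_row_dz_cong) auto
  also have "(\<lambda>k::nat. 0::complex) = (\<lambda>k. \<Sum>i\<in>({} :: nat set). 0 * 0)" by simp
  also have "secular_row_dz \<alpha> z r \<dots> = 0"
    unfolding linear_functional_sum[OF linear_secular_row_dz, of \<alpha> z r "\<lambda>_. 0" "\<lambda>_ _. 0" "{}"] by simp
  finally show ?thesis .
qed

text \<open>
  A basis of all solutions on the edges, a space of dimension \<open>2n\<close>, that extends a basis of the eigenspace;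
  \<open>K\<close> is the set of indices of the eigenfunctions and \<open>S i\<close> the coefficient vector of \<open>b i\<close>.
\<close>

lemma adapted_basis:
  obtains b S K where
    "bij_betw b {1..num_ends} (b ` {1..num_ends})" "graph_fun.independent (b ` {1..num_ends})"
    "\<And>i. i \<in> {1..num_ends} \<Longrightarrow> b i = graph_sol z (S i)"
    "K \<subseteq> {1..num_ends}" "card K = eigenvalue_multiplicity (laplacian G \<alpha>) z"
    "b ` K \<subseteq> eigenspace (laplacian G \<alpha>) z"
    "eigenspace (laplacian G \<alpha>) z \<subseteq> graph_fun.span (b ` K)"
proof -
  let ?I = "{1..num_ends}" and ?E = "eigenspace (laplacian G \<alpha>) z"
  let ?w = "\<lambda>i. graph_sol z (unit_coeff i)"
  define W where "W = ?w ` ?I"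
  have expand: "graph_sol z v = (\<Sum>i\<in>?I. graph_scale (v i) (?w i))" for v
  proof -
    have "graph_sol z v = graph_sol z (\<lambda>k. \<Sum>i\<in>?I. v i * unit_coeff i k)"
      by (rule graph_sol_cong) (simp add: unit_coeff_def if_distrib[of "(*) _"] cong: if_cong)
    then show ?thesis by (simp only: graph_sol_linear)
  qed
  have inj: "inj_on ?w ?I"
  proof (rule inj_onI, rule ccontr)
    fix i j assume ij: "i \<in> ?I" "j \<in> ?I" "?w i = ?w j" "i \<noteq> j"
    have "graph_sol z (\<lambda>k. \<Sum>l\<in>{i, j}. (if l = i then 1 else -1) * unit_coeff l k)
        = graph_scale 1 (?w i) + graph_scale (-1) (?w j)"
      unfolding graph_sol_linear using ij(4) by simp
    also have "\<dots> = 0" using ij(3) by (simp add: fun_eq_iff graph_scale_def)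
    finally have "(\<Sum>l\<in>{i, j}. (if l = i then 1 else -1) * unit_coeff l i) = 0"
      unfolding graph_sol_eq_0_iff using ij(1) by blast
    then show False using ij(4) by (simp add: unit_coeff_def)
  qed
  have cardW: "card W = num_ends" "finite W"
    unfolding W_def card_image[OF inj] by simp_all
  have indW: "graph_fun.independent W"
  proof
    assume "graph_fun.dependent W"
    then obtain u f where u: "f \<in> W" "u f \<noteq> 0" "(\<Sum>f\<in>W. graph_scale (u f) f) = 0"
      unfolding graph_fun.dependent_finite[OF cardW(2)] by blast
    have "(\<Sum>f\<in>W. graph_scale (u f) f) = (\<Sum>i\<in>?I. graph_scale (u (?w i)) (?w i))"
      unfolding W_def sum.reindex[OF inj] by (simp add: o_def)
    then have "graph_sol z (\<lambda>i. u (?w i)) = 0" using u(3) expand[of "\<lambda>i. u (?w i)"] by simp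
    then show False using u(1,2) unfolding graph_sol_eq_0_iff W_def by blast
  qed
  have spanW: "range (graph_sol z) \<subseteq> graph_fun.span W"
  proof
    fix f assume "f \<in> range (graph_sol z)"
    then obtain v where "f = (\<Sum>i\<in>?I. graph_scale (v i) (?w i))" using expand by blast
    moreover have "graph_scale (v i) (?w i) \<in> graph_fun.span W" if "i \<in> ?I" for i
      using that unfolding W_def by (intro graph_fun.span_scale graph_fun.span_base imageI)
    ultimately show "f \<in> graph_fun.span W" by (simp only: graph_fun.span_sum)
  qed
  obtain B where B: "B \<subseteq> ?E" "graph_fun.independent B" "?E \<subseteq> graph_fun.span B"
    "card B = graph_fun.dim ?E" by (rule graph_fun.basis_exists)
  have "B \<subseteq> range (graph_sol z)" using B(1) unfolding eigenspace_eq_secular_kernel by blast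
  from graph_fun.maximal_independent_subset_extend[OF this B(2)]
  obtain B' where B': "B \<subseteq> B'" "B' \<subseteq> range (graph_sol z)" "graph_fun.independent B'"
    "range (graph_sol z) \<subseteq> graph_fun.span B'" by blast
  have fin: "finite B'" "card B' \<le> num_ends"
    using graph_fun.independent_span_bound[OF cardW(2) B'(3)] B'(2) spanW cardW(1) by auto
  have "W \<subseteq> graph_fun.span B'" using B'(4) unfolding W_def by blast
  then have "card B' = num_ends"
    using graph_fun.independent_span_bound[OF fin(1) indW] cardW(1) fin(2) by auto
  then obtain b where b: "bij_betw b ?I B'"
    using ex_bij_betw_nat_finite_1[OF fin(1)] by auto
  have b_img: "b ` ?I = B'" using b by (simp add: bij_betw_def)
  have "\<forall>i\<in>?I. \<exists>v. b i = graph_sol z v" using b_img B'(2) by blast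
  then obtain S where S: "\<And>i. i \<in> ?I \<Longrightarrow> b i = graph_sol z (S i)" by metis
  define K where "K = {i \<in> ?I. b i \<in> B}"
  have K: "b ` K = B" using b_img B'(1) unfolding K_def by blast
  have "inj_on b K" by (rule inj_on_subset[OF bij_betw_imp_inj_on[OF b]]) (auto simp: K_def)
  from card_image[OF this] have "card K = card B" unfolding K by simp
  then have "card K = eigenvalue_multiplicity (laplacian G \<alpha>) z"
    using B(4) by (simp add: eigenvalue_multiplicity_def)
  moreover have "K \<subseteq> ?I" unfolding K_def by blast
  ultimately show ?thesis
    using that[of b S K] b B'(3) S B(1,3) unfolding b_img K by blast
qed

text \<open>
  In an adapted basis the columns of the secular matrix that belong to eigenfunctions vanish at \<open>z\<close>.
  Each of them contributes a factor \<open>w - z\<close>, and after division by these factors the limit matrix has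
  the derivatives of the secular rows in these columns.  It is nonsingular by
  \<open>secular_kernel_transversal\<close>, or by \<open>secular_kernel_trivial\<close> for nonreal \<open>z\<close>.
\<close>

proposition secular_det_order:
  "\<exists>g. g \<noteq> 0 \<and>
     ((\<lambda>w. secular_det \<alpha> w / (w - z) ^ eigenvalue_multiplicity (laplacian G \<alpha>) z) \<longlongrightarrow> g) (at z)"
proof -
  let ?I = "{1..num_ends}" and ?E = "eigenspace (laplacian G \<alpha>) z"
  obtain b S K where b: "bij_betw b ?I (b ` ?I)" and ind: "graph_fun.independent (b ` ?I)"
    and S: "\<And>i. i \<in> ?I \<Longrightarrow> b i = graph_sol z (S i)"
    and K: "K \<subseteq> ?I" "card K = eigenvalue_multiplicity (laplacian G \<alpha>) z"
    and KE: "b ` K \<subseteq> ?E" "?E \<subseteq> graph_fun.span (b ` K)"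
    by (rule adapted_basis[where z = z and \<alpha> = \<alpha>], rule that)
  note indep = graph_fun_independent_family[OF b finite_atLeastAtMost ind]
  have sol_sum: "graph_sol z (\<lambda>k. \<Sum>i\<in>J. y i * S i k) = (\<Sum>i\<in>J. graph_scale (y i) (b i))"
    if "J \<subseteq> ?I" for J y
    unfolding graph_sol_linear using that S by (intro sum.cong) auto
  have kernel: "secular_row \<alpha> z r (S i) = 0" if "i \<in> K" "r \<in> ?I" for i r
  proof -
    have "graph_sol z (S i) \<in> ?E" using that(1) K(1) KE(1) S by force
    then show ?thesis using that(2) graph_sol_in_eigenspace_iff by blast
  qed
  \<comment> \<open>the change of basis is invertible\<close>
  have detS: "square_det num_ends (\<lambda>k i. S i k) \<noteq> 0"
  proof
    assume "square_det num_ends (\<lambda>k i. S i k) = 0"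
    then obtain y i where y: "i \<in> ?I" "y i \<noteq> 0" "\<forall>k\<in>?I. (\<Sum>i\<in>?I. S i k * y i) = 0"
      unfolding square_det_eq_0_iff by blast
    then have "\<forall>k\<in>?I. (\<Sum>i\<in>?I. y i * S i k) = 0" by (simp only: mult.commute)
    then have "graph_sol z (\<lambda>k. \<Sum>i\<in>?I. y i * S i k) = 0" unfolding graph_sol_eq_0_iff .
    then have "(\<Sum>i\<in>?I. graph_scale (y i) (b i)) = 0" unfolding sol_sum[OF order_refl] .
    from indep[OF this y(1)] y(2) show False by contradiction
  qed
  define M where "M w r i = (if i \<in> K then secular_row \<alpha> w r (S i) / (w - z)
    else secular_row \<alpha> w r (S i))" for w r i
  define L where "L r i = (if i \<in> K then secular_row_dz \<alpha> z r (S i)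
    else secular_row \<alpha> z r (S i))" for r i
  have detL: "square_det num_ends L \<noteq> 0"
  proof
    assume "square_det num_ends L = 0"
    then obtain y j where y: "j \<in> ?I" "y j \<noteq> 0" "\<And>r. r \<in> ?I \<Longrightarrow> (\<Sum>i\<in>?I. L r i * y i) = 0"
      unfolding square_det_eq_0_iff by blast
    define v where "v = (\<lambda>k. \<Sum>i\<in>K. y i * S i k)"
    define w where "w = (\<lambda>k. \<Sum>i\<in>?I - K. y i * S i k)"
    have "secular_row_dz \<alpha> z r v + secular_row \<alpha> z r w = (\<Sum>i\<in>?I. L r i * y i)" for r
    proof -
      have "(\<Sum>i\<in>?I. L r i * y i) = (\<Sum>i\<in>?I - K. L r i * y i) + (\<Sum>i\<in>K. L r i * y i)"
        by (rule sum.subset_diff[OF K(1)]) simp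
      then show ?thesis
        unfolding v_def w_def linear_functional_sum[OF linear_secular_row]
          linear_functional_sum[OF linear_secular_row_dz]
        by (simp add: L_def mult.commute)
    qed
    then have rows: "\<forall>r\<in>?I. secular_row_dz \<alpha> z r v + secular_row \<alpha> z r w = 0" using y(3) by simp
    have vker: "\<forall>r\<in>?I. secular_row \<alpha> z r v = 0"
      unfolding v_def linear_functional_sum[OF linear_secular_row] using kernel by simp
    have v0: "v k = 0" if "k \<in> ?I" for k
      using secular_kernel_trivial[OF _ vker that] secular_kernel_transversal[OF _ vker rows that]
      by blast
    \<comment> \<open>the part along the eigenfunctions vanishes\<close>
    have yK: "y i = 0" if "i \<in> K" for i
    proof -
      have "graph_sol z v = 0" unfolding graph_sol_eq_0_iff using v0 by blast
      then have "(\<Sum>i\<in>K. graph_scale (y i) (b i)) = 0" unfolding v_def sol_sum[OF K(1)] .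
      moreover have "(\<Sum>i\<in>?I. graph_scale (if i \<in> K then y i else 0) (b i))
          = (\<Sum>i\<in>K. graph_scale (y i) (b i))"
        using K(1) by (intro sum.mono_neutral_cong_right) auto
      ultimately show ?thesis
        using indep[of "\<lambda>i. if i \<in> K then y i else 0" i] that K(1) by auto
    qed
    \<comment> \<open>the remaining part is an eigenfunction, so it lies in the span of \<open>b ` K\<close>\<close>
    have "\<forall>r\<in>?I. secular_row \<alpha> z r w = 0"
      using rows secular_row_dz_zero[OF _ v0] by simp
    then have "graph_sol z w \<in> graph_fun.span (b ` K)"
      using graph_sol_in_eigenspace_iff KE(2) by blast
    moreover have "finite K" using K(1) finite_subset by blast
    ultimately obtain u where u: "graph_sol z w = (\<Sum>f\<in>b ` K. graph_scale (u f) f)"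
      unfolding graph_fun.span_finite[OF finite_imageI[OF \<open>finite K\<close>]] by blast
    have "inj_on b K" by (rule inj_on_subset[OF bij_betw_imp_inj_on[OF b] K(1)])
    then have u: "graph_sol z w = (\<Sum>i\<in>K. graph_scale (u (b i)) (b i))"
      using u by (simp add: sum.reindex)
    define c where "c i = (if i \<in> K then - u (b i) else y i)" for i
    have "(\<Sum>i\<in>?I. graph_scale (c i) (b i))
        = (\<Sum>i\<in>?I - K. graph_scale (c i) (b i)) + (\<Sum>i\<in>K. graph_scale (c i) (b i))"
      by (rule sum.subset_diff[OF K(1)]) simp
    also have "(\<Sum>i\<in>?I - K. graph_scale (c i) (b i)) = graph_sol z w"
      unfolding w_def by (subst sol_sum) (auto simp: c_def intro!: sum.cong)
    also have "(\<Sum>i\<in>K. graph_scale (c i) (b i)) = - graph_sol z w"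
      unfolding u sum_negf[symmetric] by (intro sum.cong) (auto simp: c_def)
    finally have "(\<Sum>i\<in>?I. graph_scale (c i) (b i)) = 0" by (simp only: add.right_inverse)
    then have "c j = 0" using indep y(1) by blast
    then show False using y(2) yK unfolding c_def by (cases "j \<in> K") auto
  qed
  have "((\<lambda>w. square_det num_ends (M w)) \<longlongrightarrow> square_det num_ends L) (at z)"
  proof (rule tendsto_square_det)
    fix r i assume r: "r \<in> ?I" and i: "i \<in> ?I"
    note d = secular_row_DERIV[of \<alpha> r "S i" z]
    show "((\<lambda>w. M w r i) \<longlongrightarrow> L r i) (at z)"
    proof (cases "i \<in> K")
      case True
      then show ?thesis
        using d unfolding has_field_derivative_iff by (simp add: M_def L_def kernel[OF _ r])
    next
      case False
      then show ?thesis
        using DERIV_isCont[OF d] by (simp add: M_def L_def isCont_def)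
    qed
  qed
  moreover have "secular_det \<alpha> w / (w - z) ^ card K
      = square_det num_ends (M w) / square_det num_ends (\<lambda>k i. S i k)" if "w \<noteq> z" for w
  proof -
    have "secular_det \<alpha> w * square_det num_ends (\<lambda>k i. S i k)
        = square_det num_ends (\<lambda>r i. secular_row \<alpha> w r (S i))"
      unfolding secular_det_def square_det_mult[symmetric]
      by (rule square_det_cong) (simp only: secular_row_expand[symmetric])
    also have "\<dots> = square_det num_ends (\<lambda>r i. (if i \<in> K then w - z else 1) * M w r i)"
      using that by (intro square_det_cong) (simp add: M_def)
    also have "\<dots> = (\<Prod>i\<in>?I. if i \<in> K then w - z else 1) * square_det num_ends (M w)"
      by (rule square_det_scale_columns)
    also have "(\<Prod>i\<in>?I. if i \<in> K then w - z else 1) = (w - z) ^ card K"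
      using K(1) by (simp add: prod.If_cases Int_absorb1 flip: prod.inter_restrict)
    finally show ?thesis
      using that detS by (simp add: field_simps)
  qed
  then have "eventually (\<lambda>w. secular_det \<alpha> w / (w - z) ^ card K
      = square_det num_ends (M w) / square_det num_ends (\<lambda>k i. S i k)) (at z)"
    by (auto simp: eventually_at_filter)
  ultimately have "((\<lambda>w. secular_det \<alpha> w / (w - z) ^ card K) \<longlongrightarrow>
      square_det num_ends L / square_det num_ends (\<lambda>k i. S i k)) (at z)"
    using detS by (subst tendsto_cong) (auto intro!: tendsto_divide)
  then show ?thesis
    using detL detS unfolding K(2)
    by (intro exI[of _ "square_det num_ends L / square_det num_ends (\<lambda>k i. S i k)"]) simp
qed

end

section \<open>Isospectral Laplacians have proportional secular determinants\<close>

text \<open>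
  The quotient has a nonzero limit at every point, hence only removable singularities.
\<close>

lemma entire_removable_ratio:
  assumes f: "f holomorphic_on UNIV" and g: "g holomorphic_on UNIV"
    and "\<And>z. \<exists>n a b. a \<noteq> 0 \<and> b \<noteq> 0 \<and> ((\<lambda>w. f w / (w - z) ^ n) \<longlongrightarrow> a) (at z) \<and>
           ((\<lambda>w. g w / (w - z) ^ n) \<longlongrightarrow> b) (at z)"
  obtains q where "q holomorphic_on UNIV" "\<And>z. q z \<noteq> 0" "\<And>z. f z = q z * g z"
proof -
  let ?r = "\<lambda>w. f w / g w"
  have local: "\<exists>c. c \<noteq> 0 \<and> (?r \<longlongrightarrow> c) (at z) \<and> eventually (\<lambda>w. g w \<noteq> 0) (at z)" for z
  proof -
    obtain n a b where n: "a \<noteq> 0" "b \<noteq> 0" "((\<lambda>w. f w / (w - z) ^ n) \<longlongrightarrow> a) (at z)"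
      "((\<lambda>w. g w / (w - z) ^ n) \<longlongrightarrow> b) (at z)" using assms(3) by blast
    have ne: "eventually (\<lambda>w. w \<noteq> z) (at z)" by (simp add: eventually_at_filter)
    have "((\<lambda>w. (f w / (w - z) ^ n) / (g w / (w - z) ^ n)) \<longlongrightarrow> a / b) (at z)"
      by (intro tendsto_divide n)
    then have "(?r \<longlongrightarrow> a / b) (at z)"
    proof (rule Lim_transform_eventually)
      show "eventually (\<lambda>w. f w / (w - z) ^ n / (g w / (w - z) ^ n) = ?r w) (at z)"
        using ne by eventually_elim simp
    qed
    moreover have "eventually (\<lambda>w. g w \<noteq> 0) (at z)"
      using tendsto_imp_eventually_ne[OF n(4,2)] by eventually_elim auto
    ultimately show ?thesis using n(1,2) by (intro exI[of _ "a / b"]) auto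
  qed
  define q where "q = remove_sings ?r"
  have q_lim: "(?r \<longlongrightarrow> q z) (at z)" "q z \<noteq> 0" for z
    using local[of z] unfolding q_def by (metis remove_sings_eqI)+
  show ?thesis
  proof
    have "q analytic_on {z}" for z
      unfolding q_def
    proof (rule remove_sings_analytic_at)
      show "(?r \<longlongrightarrow> q z) (at z)" by (rule q_lim)
      obtain e where e: "e > 0" "\<And>w. w \<noteq> z \<Longrightarrow> dist w z < e \<Longrightarrow> g w \<noteq> 0"
        using local[of z] unfolding eventually_at by auto
      have "?r holomorphic_on (ball z e - {z})"
        using e(2) by (intro holomorphic_on_divide holomorphic_on_subset[OF f] holomorphic_on_subset[OF g])
          (auto simp: dist_commute)
      then show "isolated_singularity_at ?r z"
        unfolding isolated_singularity_at_def using e(1)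
        by (intro exI[of _ e]) (simp add: analytic_on_open open_Diff)
    qed
    then show "q holomorphic_on UNIV"
      using analytic_imp_holomorphic analytic_on_analytic_at by blast
    show "q z \<noteq> 0" for z by (rule q_lim)
    show "f z = q z * g z" for z
    proof (rule tendsto_unique[of "at z"])
      have "isCont f z" "isCont g z"
        using f g by (auto simp: holomorphic_on_open field_differentiable_def
            intro: DERIV_isCont dest!: holomorphic_on_imp_differentiable_at[where s = UNIV])
      then show "(f \<longlongrightarrow> f z) (at z)" by (simp add: isCont_def)
      have "((\<lambda>w. ?r w * g w) \<longlongrightarrow> q z * g z) (at z)"
        using \<open>isCont g z\<close> by (intro tendsto_mult q_lim) (simp add: isCont_def)
      then show "(f \<longlongrightarrow> q z * g z) (at z)"
        by (rule Lim_transform_eventually) (use local[of z] in \<open>auto elim!: eventually_mono\<close>)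
    qed simp
  qed
qed

text \<open>
  An entire logarithm \<open>h\<close> of \<open>q\<close> differs from \<open>L\<close> by a constant on either open half plane, so
  its imaginary part is bounded off the real axis, and by continuity everywhere.  Such an entire function
  omits more than one value and is constant by Picard's theorem.
\<close>

lemma entire_constant_if_log_bounded_on_half_planes:
  assumes q: "q holomorphic_on UNIV" "\<And>z. q z \<noteq> 0"
    and L: "L holomorphic_on {z. Im z \<noteq> 0}" "\<And>z. Im z \<noteq> 0 \<Longrightarrow> exp (L z) = q z"
      "\<And>z. Im z \<noteq> 0 \<Longrightarrow> \<bar>Im (L z)\<bar> \<le> C"
  obtains c where "\<And>z. q z = c"
proof -
  obtain h where h: "h holomorphic_on UNIV" "\<And>z. exp (h z) = q z"
    using holomorphic_logarithm_exists[of UNIV q 0] q by auto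
  have half: "\<exists>B. \<forall>z\<in>H. \<bar>Im (h z)\<bar> \<le> B"
    if H: "open H" "convex H" "H \<subseteq> {z. Im z \<noteq> 0}" for H
  proof -
    have "\<exists>c. \<forall>z\<in>H. h z - L z = c"
    proof (rule has_field_derivative_zero_constant[OF H(2)])
      fix z assume z: "z \<in> H"
      let ?d = "\<lambda>z. h z - L z"
      have "?d holomorphic_on H"
        using h(1) L(1) H(3) by (intro holomorphic_on_diff) (auto intro: holomorphic_on_subset)
      then have d: "(?d has_field_derivative deriv ?d z) (at z)"
        using H(1) z by (rule holomorphic_derivI)
      have "((\<lambda>z. exp (?d z)) has_field_derivative exp (?d z) * deriv ?d z) (at z)"
        by (rule DERIV_fun_exp[OF d])
      moreover have "((\<lambda>z. exp (?d z)) has_field_derivative 0) (at z)"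
      proof (rule has_field_derivative_transform_within_open[OF DERIV_const H(1) z])
        fix w assume "w \<in> H"
        then show "1 = exp (?d w)" using H(3) L(2) h(2) q(2) by (auto simp: exp_diff)
      qed
      ultimately have "exp (?d z) * deriv ?d z = 0" by (rule DERIV_unique)
      then show "(?d has_field_derivative 0) (at z within H)"
        using has_field_derivative_at_within[OF d, of H] by simp
    qed
    then obtain c where c: "\<And>z. z \<in> H \<Longrightarrow> h z = L z + c" by (metis diff_eq_eq add.commute)
    have "\<bar>Im (h z)\<bar> \<le> C + \<bar>Im c\<bar>" if "z \<in> H" for z
    proof -
      have "\<bar>Im (L z)\<bar> \<le> C" using L(3) H(3) that by blast
      then show ?thesis using c[OF that] by simp
    qed
    then show ?thesis by blast
  qed
  have "{z. Im z > 0} \<subseteq> {z. Im z \<noteq> 0}" "{z. Im z < 0} \<subseteq> {z. Im z \<noteq> 0}" by auto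
  then obtain B1 B2 where B1: "\<forall>z\<in>{z. Im z > 0}. \<bar>Im (h z)\<bar> \<le> B1"
    and B2: "\<forall>z\<in>{z. Im z < 0}. \<bar>Im (h z)\<bar> \<le> B2"
    using half[OF open_halfspace_Im_gt convex_halfspace_Im_gt]
      half[OF open_halfspace_Im_lt convex_halfspace_Im_lt] by metis
  define B where "B = max B1 B2"
  have B: "\<bar>Im (h z)\<bar> \<le> B" for z
  proof -
    have "{z. Im z \<noteq> 0} = - {z. \<i> \<bullet> z = 0}" by (auto simp: inner_complex_def)
    moreover have "interior {z :: complex. \<i> \<bullet> z = 0} = {}" by (rule interior_hyperplane) simp
    ultimately have "closure {z. Im z \<noteq> 0} = UNIV" by (simp only: closure_complement Compl_empty_eq)
    then have z: "z \<in> closure {z. Im z \<noteq> 0}" by simp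
    show ?thesis
    proof (rule continuous_le_on_closure[OF _ z])
      show "continuous_on (closure {z. Im z \<noteq> 0}) (\<lambda>z. \<bar>Im (h z)\<bar>)"
        using holomorphic_on_imp_continuous_on[OF h(1)]
        by (intro continuous_intros) (auto intro: continuous_on_subset)
      fix w assume "w \<in> {z. Im z \<noteq> 0}"
      then show "\<bar>Im (h w)\<bar> \<le> B"
        using B1 B2 unfolding B_def by (auto simp: neq_iff le_max_iff_disj)
    qed
  qed
  \<comment> \<open>two omitted values, for Picard's theorem\<close>
  have "range h \<inter> {\<i> * of_real (B + 1), \<i> * of_real (B + 2)} = {}"
  proof -
    have "h z \<noteq> \<i> * of_real x" if "x > B" for z x
    proof
      assume "h z = \<i> * of_real x"
      then have "Im (h z) = x" by simp
      then show False using B[of z] that by simp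
    qed
    from this[of "B + 1"] this[of "B + 2"]
    have "h z \<notin> {\<i> * of_real (B + 1), \<i> * of_real (B + 2)}" for z
      by (simp del: of_real_add)
    then show ?thesis by blast
  qed
  then obtain c where "h = (\<lambda>_. c)"
    using little_Picard[OF h(1), of "\<i> * of_real (B + 1)" "\<i> * of_real (B + 2)"]
    by (auto simp: complex_eq_iff)
  then show ?thesis using that[of "exp c"] h(2) by metis
qed

context metric_graph
begin

lemma secular_row_coupling_update:
  assumes "m \<in> {1..num_vertices G}"
  obtains g where "\<And>a r v. secular_row (\<alpha>(m := a)) z r v
     = secular_row (\<alpha>(m := 0)) z r v + (if r = vertex_rep m then of_real a * g v else 0)"
proof
  fix a r v
  show "secular_row (\<alpha>(m := a)) z r v = secular_row (\<alpha>(m := 0)) z r v + (if r = vertex_rep m then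
      of_real a * - ((\<Sum>k\<in>vertex G m. continuous_data m (edge_trace (edge_sol z) v)
        (\<lambda>k. end_sign k * edge_trace (edge_sol_deriv z) v k) k) / of_real (real (valence G m))) else 0)"
  proof (cases "r = vertex_rep m")
    case True
    then show ?thesis
      by (simp add: secular_row_def coupling_row_def Let_def vertex_rep[OF assms])
  next
    case False
    then show ?thesis
      by (cases "vertex_of r = m") (auto simp: secular_row_def coupling_row_def Let_def)
  qed
qed

lemma secular_det_affine:
  assumes m: "m \<in> {1..num_vertices G}"
  shows "\<exists>A B. \<forall>a. secular_det (\<alpha>(m := a)) z = A + of_real a * B"
proof -
  obtain g where g: "\<And>a r v. secular_row (\<alpha>(m := a)) z r v
     = secular_row (\<alpha>(m := 0)) z r v + (if r = vertex_rep m then of_real a * g v else 0)"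
    by (rule secular_row_coupling_update[OF m, of \<alpha> z], rule that)
  have "secular_det (\<alpha>(m := a)) z = square_det num_ends (\<lambda>r i. secular_row (\<alpha>(m := 0)) z r (unit_coeff i)
      + (if r = vertex_rep m then of_real a * g (unit_coeff i) else 0))" for a
    unfolding secular_det_def by (rule square_det_cong) (rule g)
  moreover obtain A B where "\<And>a. square_det num_ends (\<lambda>r i. secular_row (\<alpha>(m := 0)) z r (unit_coeff i)
      + (if r = vertex_rep m then a * g (unit_coeff i) else 0)) = A + a * B"
    using square_det_affine_in_row[OF vertex_rep(2)[OF m]] by metis
  ultimately show ?thesis by metis
qed

text \<open>
  As a function of \<open>\<alpha> m\<close> the determinant is affine, say \<open>A + \<alpha> m * B\<close>.  If the ratio were
  \<open>\<rho> \<le> 0\<close>, then \<open>A + c * B = 0\<close> for the real number \<open>c = (a - \<rho> * \<alpha> m) / (1 - \<rho>)\<close>, a convex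
  combination of \<open>a\<close> and \<open>\<alpha> m\<close>; but no determinant with real coupling constants vanishes at \<open>z\<close>.
\<close>

lemma secular_det_ratio_not_nonpos:
  assumes m: "m \<in> {1..num_vertices G}" and z: "Im z \<noteq> 0"
  shows "secular_det (\<alpha>(m := a)) z / secular_det \<alpha> z \<notin> \<real>\<^sub>\<le>\<^sub>0"
proof
  assume "secular_det (\<alpha>(m := a)) z / secular_det \<alpha> z \<in> \<real>\<^sub>\<le>\<^sub>0"
  then obtain \<rho> where \<rho>: "\<rho> \<le> 0" "secular_det (\<alpha>(m := a)) z / secular_det \<alpha> z = of_real \<rho>"
    unfolding nonpos_Reals_def by auto
  obtain A B where AB: "\<And>a. secular_det (\<alpha>(m := a)) z = A + of_real a * B"
    using secular_det_affine[OF m] by metis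
  define c where "c = (a - \<rho> * \<alpha> m) / (1 - \<rho>)"
  have "secular_det (\<alpha>(m := a)) z = of_real \<rho> * secular_det \<alpha> z"
    using \<rho>(2) secular_det_nonreal[OF z, of \<alpha>] by (simp add: field_simps)
  moreover have "secular_det \<alpha> z = A + of_real (\<alpha> m) * B" using AB[of "\<alpha> m"] by simp
  ultimately have "(1 - of_real \<rho>) * A + (of_real a - of_real \<rho> * of_real (\<alpha> m)) * B = 0"
    using AB[of a] by (simp add: algebra_simps)
  moreover have "complex_of_real c * (1 - of_real \<rho>) = of_real a - of_real \<rho> * of_real (\<alpha> m)"
  proof -
    have "c * (1 - \<rho>) = a - \<rho> * \<alpha> m" using \<rho>(1) by (simp add: c_def)
    from arg_cong[OF this, of complex_of_real] show ?thesis by simp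
  qed
  ultimately have "(1 - of_real \<rho>) * (A + of_real c * B) = 0"
    by (metis (no_types, lifting) distrib_left mult.assoc mult.commute)
  moreover have "1 - complex_of_real \<rho> \<noteq> 0" using \<rho>(1) by (simp add: complex_eq_iff)
  ultimately have "secular_det (\<alpha>(m := c)) z = 0" using AB[of c] by simp
  then show False using secular_det_nonreal[OF z] by blast
qed

text \<open>
  The coupling constants are changed one vertex at a time, and each change contributes a principal
  logarithm.
\<close>

lemma secular_det_log_ratio:
  assumes "finite I" "I \<subseteq> {1..num_vertices G}"
  shows "\<exists>L. L holomorphic_on {z. Im z \<noteq> 0} \<and>
     (\<forall>z. Im z \<noteq> 0 \<longrightarrow> exp (L z) = secular_det (override_on \<alpha> \<beta> I) z / secular_det \<alpha> z \<and>
       \<bar>Im (L z)\<bar> \<le> real (card I) * pi)"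
  using assms
proof (induction I)
  case empty
  show ?case
    by (rule exI[of _ "\<lambda>_. 0"]) (use secular_det_nonreal in auto)
next
  case (insert m I)
  then obtain L where L: "L holomorphic_on {z. Im z \<noteq> 0}"
    "\<And>z. Im z \<noteq> 0 \<Longrightarrow> exp (L z) = secular_det (override_on \<alpha> \<beta> I) z / secular_det \<alpha> z"
    "\<And>z. Im z \<noteq> 0 \<Longrightarrow> \<bar>Im (L z)\<bar> \<le> real (card I) * pi" by auto
  define \<gamma> where "\<gamma> = override_on \<alpha> \<beta> I"
  let ?r = "\<lambda>z. secular_det (\<gamma>(m := \<beta> m)) z / secular_det \<gamma> z"
  have upd: "override_on \<alpha> \<beta> (insert m I) = \<gamma>(m := \<beta> m)"
    by (auto simp: fun_eq_iff override_on_def \<gamma>_def)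
  have m: "m \<in> {1..num_vertices G}" using insert.prems by blast
  note np = secular_det_ratio_not_nonpos[OF m]
  have r0: "?r z \<noteq> 0" if "Im z \<noteq> 0" for z using secular_det_nonreal[OF that] by simp
  show ?case
  proof (intro exI conjI allI impI)
    have "?r holomorphic_on {z. Im z \<noteq> 0}"
      using secular_det_nonreal by (intro holomorphic_on_divide holomorphic_secular_det) auto
    then show "(\<lambda>z. L z + Ln (?r z)) holomorphic_on {z. Im z \<noteq> 0}"
      using np by (intro holomorphic_on_add L(1) holomorphic_on_Ln') auto
    fix z assume z: "Im z \<noteq> 0"
    show "exp (L z + Ln (?r z)) = secular_det (override_on \<alpha> \<beta> (insert m I)) z / secular_det \<alpha> z"
      unfolding upd exp_add L(2)[OF z] exp_Ln[OF r0[OF z]] \<gamma>_def[symmetric]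
      using secular_det_nonreal[OF z] by simp
    have "\<bar>Im (Ln (?r z))\<bar> \<le> pi"
      using Im_Ln_le_pi[OF r0[OF z]] mpi_less_Im_Ln[OF r0[OF z]] by (simp add: abs_le_iff)
    then show "\<bar>Im (L z + Ln (?r z))\<bar> \<le> real (card (insert m I)) * pi"
      using L(3)[OF z] insert.hyps by (simp add: algebra_simps)
  qed
qed

lemma secular_det_override:
  "secular_det (override_on \<alpha> \<beta> {1..num_vertices G}) z = secular_det \<beta> z"
proof -
  have "coupling_row (override_on \<alpha> \<beta> {1..num_vertices G}) r u u' = coupling_row \<beta> r u u'"
    if "r \<in> {1..num_ends}" for r u u'
    using vertex_of(1)[OF that] by (simp add: coupling_row_def Let_def override_on_def)
  then show ?thesis
    unfolding secular_det_def secular_row_def by (intro square_det_cong)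
qed

text \<open>
  Equal multiplicities give zeros of equal order, so the quotient is entire without zeros; the logarithm
  from \<open>secular_det_log_ratio\<close> shows that it is constant.
\<close>

proposition isospectral_secular_det:
  assumes "isospectral (laplacian G \<alpha>) (laplacian G \<beta>)"
  obtains c where "c \<noteq> 0" "\<And>z. secular_det \<beta> z = c * secular_det \<alpha> z"
proof -
  let ?d = "\<lambda>\<alpha>. eigenvalue_multiplicity (laplacian G \<alpha>)"
  have mult: "?d \<alpha> z = ?d \<beta> z" for z
  proof (cases "z \<in> point_spectrum (laplacian G \<alpha>)")
    case True
    then show ?thesis using assms by (simp add: isospectral_def)
  next
    case False
    have trivial: "eigenspace (laplacian G \<gamma>) z = {0}"
      if "z \<notin> point_spectrum (laplacian G \<gamma>)" for \<gamma>
    proof -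
      have "graph_sol z (\<lambda>_. 0) = 0" unfolding graph_sol_eq_0_iff by simp
      moreover have "graph_sol z (\<lambda>_. 0) \<in> eigenspace (laplacian G \<gamma>) z"
        unfolding graph_sol_in_eigenspace_iff using secular_row_expand by simp
      ultimately show ?thesis using that unfolding point_spectrum_def by auto
    qed
    have "z \<notin> point_spectrum (laplacian G \<beta>)" using False assms by (simp add: isospectral_def)
    then show ?thesis using trivial False by (simp add: eigenvalue_multiplicity_def)
  qed
  have ord: "\<exists>n a b. a \<noteq> 0 \<and> b \<noteq> 0 \<and> ((\<lambda>w. secular_det \<beta> w / (w - z) ^ n) \<longlongrightarrow> a) (at z) \<and>
     ((\<lambda>w. secular_det \<alpha> w / (w - z) ^ n) \<longlongrightarrow> b) (at z)" for z
  proof -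
    obtain a where a: "a \<noteq> 0" "((\<lambda>w. secular_det \<beta> w / (w - z) ^ ?d \<beta> z) \<longlongrightarrow> a) (at z)"
      using secular_det_order by metis
    obtain b where b: "b \<noteq> 0" "((\<lambda>w. secular_det \<alpha> w / (w - z) ^ ?d \<alpha> z) \<longlongrightarrow> b) (at z)"
      using secular_det_order by metis
    show ?thesis
      using a b unfolding mult by (intro exI[of _ "?d \<beta> z"] exI[of _ a] exI[of _ b] conjI)
  qed
  obtain q where q: "q holomorphic_on UNIV" "\<And>z. q z \<noteq> 0"
    "\<And>z. secular_det \<beta> z = q z * secular_det \<alpha> z"
    by (rule entire_removable_ratio[OF holomorphic_secular_det holomorphic_secular_det ord], rule that)
  obtain L where L: "L holomorphic_on {z. Im z \<noteq> 0}"
    "\<And>z. Im z \<noteq> 0 \<Longrightarrow> exp (L z) = secular_det \<beta> z / secular_det \<alpha> z"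
    "\<And>z. Im z \<noteq> 0 \<Longrightarrow> \<bar>Im (L z)\<bar> \<le> real (card {1..num_vertices G}) * pi"
    using secular_det_log_ratio[of "{1..num_vertices G}" \<alpha> \<beta>] unfolding secular_det_override by auto
  have "exp (L z) = q z" if "Im z \<noteq> 0" for z
    using L(2)[OF that] q(3)[of z] secular_det_nonreal[OF that, of \<alpha>] by simp
  from entire_constant_if_log_bounded_on_half_planes[OF q(1,2) L(1) this L(3)]
  obtain c where "\<And>z. q z = c" by blast
  then show ?thesis using that[of c] q(2,3) by metis
qed

end

section \<open>Large negative energies\<close>

text \<open>
  Equality up to terms like \<open>exp (-k l)\<close>.  Decay faster than every power of \<open>k\<close> is all that is asked of
  the difference: this determines \<open>p\<close> (\<open>exp_close_unique\<close>) and is compatible with sums and products,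
  hence with determinants.
\<close>

definition exp_close :: "(real \<Rightarrow> complex) \<Rightarrow> complex poly \<Rightarrow> bool" where
  "exp_close f p \<longleftrightarrow>
     (\<forall>m. ((\<lambda>k. of_real k ^ m * (f k - poly p (of_real k))) \<longlongrightarrow> 0) at_top)"

lemma rapid_decay_mult_poly:
  assumes "\<And>m. ((\<lambda>k. of_real k ^ m * f k) \<longlongrightarrow> 0) at_top"
  shows "((\<lambda>k. of_real k ^ m * (poly q (of_real k) * f k)) \<longlongrightarrow> (0::complex)) at_top"
proof (induction q arbitrary: m)
  case (pCons a q)
  have "((\<lambda>k. a * (of_real k ^ m * f k) + of_real k ^ Suc m * (poly q (of_real k) * f k)) \<longlongrightarrow> a * 0 + 0) at_top"
    by (intro tendsto_add tendsto_mult tendsto_const assms pCons.IH)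
  then show ?case by (simp add: algebra_simps)
qed simp

lemma exp_close_poly: "exp_close (\<lambda>k. poly p (of_real k)) p"
  by (simp add: exp_close_def)

lemma exp_close_const: "exp_close (\<lambda>k. c) [:c:]"
  by (simp add: exp_close_def)

lemma exp_close_add:
  assumes "exp_close f p" "exp_close g q"
  shows "exp_close (\<lambda>k. f k + g k) (p + q)"
  unfolding exp_close_def
proof
  fix m
  have "((\<lambda>k. of_real k ^ m * (f k - poly p (of_real k)) + of_real k ^ m * (g k - poly q (of_real k))) \<longlongrightarrow> 0 + 0) at_top"
    using assms unfolding exp_close_def by (intro tendsto_add) auto
  then show "((\<lambda>k. of_real k ^ m * (f k + g k - poly (p + q) (of_real k))) \<longlongrightarrow> 0) at_top"
    by (simp add: algebra_simps)
qed

lemma exp_close_mult: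
  assumes "exp_close f p" "exp_close g q"
  shows "exp_close (\<lambda>k. f k * g k) (p * q)"
  unfolding exp_close_def
proof
  fix m
  define f' where "f' k = f k - poly p (of_real k)" for k
  define g' where "g' k = g k - poly q (of_real k)" for k
  have f: "((\<lambda>k. of_real k ^ m * f' k) \<longlongrightarrow> 0) at_top" for m
    using assms(1) by (simp add: exp_close_def f'_def)
  have g: "((\<lambda>k. of_real k ^ m * g' k) \<longlongrightarrow> 0) at_top" for m
    using assms(2) by (simp add: exp_close_def g'_def)
  have "((\<lambda>k. (of_real k ^ m * f' k) * (of_real k ^ 0 * g' k)
      + of_real k ^ m * (poly q (of_real k) * f' k)
      + of_real k ^ m * (poly p (of_real k) * g' k)) \<longlongrightarrow> 0 * 0 + 0 + 0) at_top"
    by (intro tendsto_add tendsto_mult f g rapid_decay_mult_poly)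
  then show "((\<lambda>k. of_real k ^ m * (f k * g k - poly (p * q) (of_real k))) \<longlongrightarrow> 0) at_top"
    by (simp add: f'_def g'_def algebra_simps)
qed

lemma exp_close_sum:
  assumes "\<And>i. i \<in> I \<Longrightarrow> exp_close (f i) (p i)"
  shows "exp_close (\<lambda>k. \<Sum>i\<in>I. f i k) (\<Sum>i\<in>I. p i)"
  using assms
proof (induction I rule: infinite_finite_induct)
  case (insert i I)
  then show ?case by (simp add: exp_close_add)
qed (simp_all add: exp_close_const[of 0, simplified])

lemma exp_close_prod:
  assumes "\<And>i. i \<in> I \<Longrightarrow> exp_close (f i) (p i)"
  shows "exp_close (\<lambda>k. \<Prod>i\<in>I. f i k) (\<Prod>i\<in>I. p i)"
  using assms
proof (induction I rule: infinite_finite_induct)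
  case (insert i I)
  then show ?case by (simp add: exp_close_mult)
qed (simp_all add: exp_close_const[of 1, unfolded one_pCons[symmetric]])

lemma exp_close_square_det:
  assumes "\<And>r i. r \<in> {1..n} \<Longrightarrow> i \<in> {1..n} \<Longrightarrow> exp_close (\<lambda>k. F k r i) (P r i)"
  shows "\<exists>p. exp_close (\<lambda>k. square_det n (F k)) p \<and>
     (\<forall>x. poly p x = square_det n (\<lambda>r i. poly (P r i) x))"
proof (intro exI conjI allI)
  let ?p = "\<Sum>p | p permutes {0..<n}. [:signof p:] * (\<Prod>i = 0..<n. P (Suc i) (Suc (p i)))"
  show "exp_close (\<lambda>k. square_det n (F k)) ?p"
    unfolding square_det_leibniz
  proof (intro exp_close_sum exp_close_mult exp_close_const exp_close_prod)
    fix p i assume "p \<in> {p. p permutes {0..<n}}" "i \<in> {0..<n}"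
    then have "p i \<in> {0..<n}"
      by (auto simp: permutes_in_image[of p "{0..<n}" i] simp del: atLeastLessThan_iff)
    then show "exp_close (\<lambda>k. F k (Suc i) (Suc (p i))) (P (Suc i) (Suc (p i)))"
      using \<open>i \<in> {0..<n}\<close> by (intro assms) auto
  qed
  show "poly ?p x = square_det n (\<lambda>r i. poly (P r i) x)" for x
    by (simp add: square_det_leibniz poly_sum poly_prod)
qed

text \<open>
  If \<open>p - q\<close> is not zero, then \<open>k * (p - q)(k)\<close> is not constant and tends to infinity.
\<close>

lemma exp_close_unique:
  assumes "exp_close f p" "exp_close f q"
  shows "p = q"
proof (rule ccontr)
  assume "p \<noteq> q"
  define r where "r = p - q"
  have "r \<noteq> 0" using \<open>p \<noteq> q\<close> by (simp add: r_def)
  then obtain R where R: "\<And>z. R \<le> cmod z \<Longrightarrow> 1 \<le> cmod (poly (pCons 0 r) z)"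
    using poly_infinity[of r 1 0] by blast
  have "((\<lambda>k. of_real k ^ 1 * (f k - poly q (of_real k)) - of_real k ^ 1 * (f k - poly p (of_real k))) \<longlongrightarrow> 0 - 0) at_top"
    using assms unfolding exp_close_def by (intro tendsto_diff) blast+
  then have "((\<lambda>k. poly (pCons 0 r) (of_real k)) \<longlongrightarrow> 0) at_top"
    by (simp add: r_def algebra_simps)
  then have "eventually (\<lambda>k. cmod (poly (pCons 0 r) (of_real k)) < 1) at_top"
    by (auto simp: tendsto_iff dist_norm)
  moreover have "eventually (\<lambda>k. k \<ge> \<bar>R\<bar>) at_top" by (rule eventually_ge_at_top)
  ultimately have "eventually (\<lambda>k. False) (at_top :: real filter)"
  proof eventually_elim
    case (elim k)
    then have "R \<le> cmod (of_real k)" by simp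
    from R[OF this] elim(1) show ?case by linarith
  qed
  then show False by simp
qed

lemma exp_close_decaying_exp:
  assumes "l > 0"
  shows "exp_close (\<lambda>k. of_real (exp (- k * l))) 0"
  unfolding exp_close_def
proof
  fix m :: nat
  have "((\<lambda>k. k ^ m * exp (- k * l)) \<longlongrightarrow> 0) at_top"
    using assms by real_asymp
  from tendsto_of_real[OF this, where 'a = complex]
  show "((\<lambda>k. of_real k ^ m * (complex_of_real (exp (- k * l)) - poly 0 (of_real k))) \<longlongrightarrow> 0) at_top"
    by simp
qed

context metric_graph
begin

definition opposite_end :: "nat \<Rightarrow> nat" where
  "opposite_end i = (if odd i then i + 1 else i - 1)"

definition edge_length_at :: "nat \<Rightarrow> real" where
  "edge_length_at i = end_offset (2 * endpoint_edge i)"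

text \<open>
  Coefficients of the solution for \<open>z = -k\<^sup>2\<close> that equals \<open>exp (-k d)\<close> at distance \<open>d\<close> from endpoint \<open>i\<close> on the
  edge of \<open>i\<close>, and vanishes on the other edges.
\<close>

definition exp_coeff :: "complex \<Rightarrow> nat \<Rightarrow> nat \<Rightarrow> complex" where
  "exp_coeff k i e =
     (if endpoint_edge e \<noteq> endpoint_edge i then 0
      else if odd i then (if odd e then 1 else - k)
      else exp (- k * of_real (edge_length_at i)) * (if odd e then 1 else k))"

lemma opposite_end_props:
  assumes "1 \<le> i"
  shows "endpoint_edge (opposite_end i) = endpoint_edge i" "opposite_end i \<noteq> i"
    "odd (opposite_end i) \<longleftrightarrow> even i"
    "1 \<le> e \<Longrightarrow> endpoint_edge e = endpoint_edge i \<Longrightarrow> e = i \<or> e = opposite_end i"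
proof -
  have "i = 2 * ((i - 1) div 2) + 1 \<or> i = 2 * ((i - 1) div 2) + 2" using assms by presburger
  then obtain a where a: "i = 2 * a + 1 \<or> i = 2 * a + 2" by blast
  then show "endpoint_edge (opposite_end i) = endpoint_edge i" "opposite_end i \<noteq> i"
    "odd (opposite_end i) \<longleftrightarrow> even i"
    by (auto simp: endpoint_edge_def opposite_end_def)
  assume e: "1 \<le> e" "endpoint_edge e = endpoint_edge i"
  then have "(e + 1) div 2 = a + 1" using a unfolding endpoint_edge_def by auto
  then have "e = 2 * a + 1 \<or> e = 2 * a + 2" by presburger
  then show "e = i \<or> e = opposite_end i" using a by (auto simp: opposite_end_def)
qed

lemma exp_coeff_traces:
  assumes i: "i \<in> {1..num_ends}" and e: "e \<in> {1..num_ends}" and k: "k \<noteq> 0"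
  shows "edge_trace (edge_sol (- (k\<^sup>2))) (exp_coeff k i) e
      = 1 * unit_coeff i e + exp (- k * of_real (edge_length_at i)) * unit_coeff (opposite_end i) e"
    and "end_sign e * edge_trace (edge_sol_deriv (- (k\<^sup>2))) (exp_coeff k i) e
      = 1 * (- k * unit_coeff i e)
        + exp (- k * of_real (edge_length_at i)) * (k * unit_coeff (opposite_end i) e)"
proof -
  let ?j = "endpoint_edge i" and ?f = "endpoint_edge e" and ?l = "edge_length_at i"
  let ?E = "exp (- k * of_real ?l)"
  have j1: "1 \<le> ?j" and f1: "1 \<le> ?f"
    using endpoint_edge_bounds(1)[OF i] endpoint_edge_bounds(1)[OF e] by auto
  have coeff: "exp_coeff k i (2 * ?f - 1) = (if ?f \<noteq> ?j then 0 else if odd i then 1 else ?E)"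
    "exp_coeff k i (2 * ?f) = (if ?f \<noteq> ?j then 0 else if odd i then - k else ?E * k)"
    using f1 unfolding exp_coeff_def endpoint_edge_simps(1)[OF f1] endpoint_edge_simps(2) by auto
  define c where "c = cosz (- (k\<^sup>2)) ?l"
  define s where "s = sinz (- (k\<^sup>2)) ?l"
  have E1: "?E * (c + k * s) = 1"
    unfolding c_def s_def cosz_cosh sinz_sinh by (simp add: cosh_plus_sinh exp_minus)
  have E2: "c - k * s = ?E"
    unfolding c_def s_def cosz_cosh sinz_sinh by (simp add: cosh_minus_sinh)
  have end_offset_right: "end_offset x = end_offset (2 * endpoint_edge x)" if "even x" for x
    using that unfolding endpoint_edge_def by auto
  have opp: "endpoint_edge (opposite_end i) = ?j" "opposite_end i \<noteq> i" "odd (opposite_end i) \<longleftrightarrow> even i"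
    using opposite_end_props i by auto
  consider "?f \<noteq> ?j" | "e = i" "odd i" | "e = i" "even i" | "e = opposite_end i" "odd i"
    | "e = opposite_end i" "even i"
    using opposite_end_props(4)[of i e] i e by (metis atLeastAtMost_iff)
  then have "edge_trace (edge_sol (- (k\<^sup>2))) (exp_coeff k i) e
      = 1 * unit_coeff i e + ?E * unit_coeff (opposite_end i) e \<and>
     end_sign e * edge_trace (edge_sol_deriv (- (k\<^sup>2))) (exp_coeff k i) e
      = 1 * (- k * unit_coeff i e) + ?E * (k * unit_coeff (opposite_end i) e)"
  proof cases
    case 1
    have "e \<noteq> i" "e \<noteq> opposite_end i" using 1 opp(1) by auto
    then show ?thesis
      using 1 coeff by (simp add: edge_trace_def edge_sol_def edge_sol_deriv_def unit_coeff_def)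
  next
    case 2
    then have "e = 2 * ?f - 1" unfolding endpoint_edge_def by presburger
    then have "end_offset e = 0" using end_offset_left[OF f1] by simp
    moreover have "e \<noteq> opposite_end i" using 2 opp(2) by simp
    ultimately show ?thesis
      using 2 coeff by (simp add: edge_trace_def edge_sol_def edge_sol_deriv_def unit_coeff_def end_sign_def)
  next
    case 3
    then have off: "end_offset e = ?l" "e \<noteq> opposite_end i" "even e"
      using end_offset_right[of e] opp(2) unfolding edge_length_at_def by auto
    have "?E * c + ?E * k * s = ?E * (c + k * s)"
      "?E * k * c - ?E * (- (k\<^sup>2)) * s = k * (?E * (c + k * s))"
      by (simp_all add: power2_eq_square algebra_simps)
    then show ?thesis
      using 3 off coeff unfolding E1
      by (simp add: edge_trace_def edge_sol_def edge_sol_deriv_def unit_coeff_def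
          end_sign_def flip: c_def s_def)
  next
    case 4
    then have off: "end_offset e = ?l" "e \<noteq> i" "even e" "?f = ?j"
      using end_offset_right[of e] opp unfolding edge_length_at_def by auto
    have "c + - k * s = c - k * s" "- k * c - 1 * (- (k\<^sup>2)) * s = - k * (c - k * s)"
      by (simp_all add: power2_eq_square algebra_simps)
    then show ?thesis
      using 4 off coeff unfolding E2
      by (simp add: edge_trace_def edge_sol_def edge_sol_deriv_def unit_coeff_def
          end_sign_def flip: c_def s_def)
  next
    case 5
    then have odd: "odd e" using opp(3) by simp
    then have "e = 2 * ?f - 1" unfolding endpoint_edge_def by presburger
    then have off: "end_offset e = 0" using end_offset_left[OF f1] by simp
    have "e \<noteq> i" "?f = ?j"
      using 5 opp by auto
    then show ?thesis
      using 5 odd off coeff by (simp add: edge_trace_def edge_sol_def edge_sol_deriv_def unit_coeff_def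
          end_sign_def)
  qed
  then show "edge_trace (edge_sol (- (k\<^sup>2))) (exp_coeff k i) e
      = 1 * unit_coeff i e + exp (- k * of_real (edge_length_at i)) * unit_coeff (opposite_end i) e"
    and "end_sign e * edge_trace (edge_sol_deriv (- (k\<^sup>2))) (exp_coeff k i) e
      = 1 * (- k * unit_coeff i e)
        + exp (- k * of_real (edge_length_at i)) * (k * unit_coeff (opposite_end i) e)"
    by blast+
qed

text \<open>
  Up to the exponentially small contribution of the opposite endpoint, the row only sees endpoint \<open>i\<close>, as
  if its edge were a half-line.
\<close>

lemma secular_row_exp_coeff:
  assumes "r \<in> {1..num_ends}" "i \<in> {1..num_ends}" "k \<noteq> 0"
  shows "secular_row \<alpha> (- (k\<^sup>2)) r (exp_coeff k i)
     = coupling_row \<alpha> r (unit_coeff i) (\<lambda>e. - k * unit_coeff i e)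
       + exp (- k * of_real (edge_length_at i))
         * coupling_row \<alpha> r (unit_coeff (opposite_end i)) (\<lambda>e. k * unit_coeff (opposite_end i) e)"
proof -
  let ?E = "exp (- k * of_real (edge_length_at i))" and ?o = "opposite_end i"
  have "secular_row \<alpha> (- (k\<^sup>2)) r (exp_coeff k i)
      = coupling_row \<alpha> r (\<lambda>e. 1 * unit_coeff i e + ?E * unit_coeff ?o e)
          (\<lambda>e. 1 * (- k * unit_coeff i e) + ?E * (k * unit_coeff ?o e))"
    unfolding secular_row_def
    by (rule coupling_row_cong[OF assms(1)]) (rule exp_coeff_traces[OF assms(2) _ assms(3)]; assumption)+
  then show ?thesis unfolding coupling_row_linear by simp
qed

lemma coupling_row_affine:
  "coupling_row \<alpha> r u (\<lambda>e. c * u' e)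
     = poly [:coupling_row \<alpha> r u (\<lambda>e. 0), coupling_row \<alpha> r (\<lambda>e. 0) u':] c"
  using coupling_row_linear[of \<alpha> r 1 u c "\<lambda>e. 0" "\<lambda>e. 0" u'] by simp

text \<open>
  The condition with the coupling constant at vertex \<open>m\<close>, evaluated on the function \<open>exp (-k d)\<close> on a
  half-line at \<open>m\<close>: for a \<open>\<delta>\<close> vertex it is \<open>-k - \<alpha>/\<gamma>\<close>, for a \<open>\<delta>'\<close> vertex \<open>-1 + k * \<alpha>/\<gamma>\<close>.
\<close>

definition vertex_factor :: "(nat \<Rightarrow> real) \<Rightarrow> nat \<Rightarrow> complex poly" where
  "vertex_factor \<alpha> m = (case vertex_mark G m of
     Delta \<Rightarrow> [:- of_real (\<alpha> m / real (valence G m)), -1:]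
   | Delta_prime \<Rightarrow> [:-1, of_real (\<alpha> m / real (valence G m)):])"

definition row_factor :: "(nat \<Rightarrow> real) \<Rightarrow> complex \<Rightarrow> nat \<Rightarrow> complex" where
  "row_factor \<alpha> k r = (if r = vertex_rep (vertex_of r) then poly (vertex_factor \<alpha> (vertex_of r)) k
     else case vertex_mark G (vertex_of r) of Delta \<Rightarrow> 1 | Delta_prime \<Rightarrow> - k)"

text \<open>
  What remains of the half-line matrix after a factor depending on \<open>k\<close> has been taken out of each row.  It
  depends on the partition into vertices only, so that its determinant cancels between two sets of
  coupling constants.
\<close>

definition vertex_matrix :: "nat \<Rightarrow> nat \<Rightarrow> complex" where
  "vertex_matrix r i =
     (if r = vertex_rep (vertex_of r) then \<Sum>e\<in>vertex G (vertex_of r). unit_coeff i e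
      else unit_coeff i r - unit_coeff i (vertex_rep (vertex_of r)))"

lemma coupling_row_half_line:
  "coupling_row \<alpha> r (unit_coeff i) (\<lambda>e. - k * unit_coeff i e) = row_factor \<alpha> k r * vertex_matrix r i"
  by (cases "vertex_mark G (vertex_of r)")
    (auto simp: coupling_row_def Let_def continuous_data_def balanced_data_def row_factor_def
      vertex_factor_def vertex_matrix_def sum_negf sum_distrib_left[symmetric] algebra_simps)

text \<open>
  A vector in the kernel is constant on each vertex, and its sum over each vertex is zero.
\<close>

lemma vertex_matrix_nonsingular: "square_det num_ends vertex_matrix \<noteq> 0"
proof
  assume "square_det num_ends vertex_matrix = 0"
  then obtain y j where j: "j \<in> {1..num_ends}" "y j \<noteq> 0"
    and y: "\<And>r. r \<in> {1..num_ends} \<Longrightarrow> (\<Sum>i\<in>{1..num_ends}. vertex_matrix r i * y i) = 0"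
    unfolding square_det_eq_0_iff by blast
  define m where "m = vertex_of j"
  have m: "m \<in> {1..num_vertices G}" "j \<in> vertex G m" using vertex_of[OF j(1)] by (auto simp: m_def)
  have unit: "(\<Sum>i\<in>{1..num_ends}. unit_coeff i e * y i) = y e" if "e \<in> {1..num_ends}" for e
    using that by (simp add: unit_coeff_def if_distrib[of "\<lambda>x. x * _"] cong: if_cong)
  have same: "y e = y (vertex_rep m)" if e: "e \<in> vertex G m" for e
  proof (cases "e = vertex_rep m")
    case False
    have e': "e \<in> {1..num_ends}" using vertex_subset[OF m(1)] e by blast
    have "(\<Sum>i\<in>{1..num_ends}. vertex_matrix e i * y i)
        = (\<Sum>i\<in>{1..num_ends}. unit_coeff i e * y i) - (\<Sum>i\<in>{1..num_ends}. unit_coeff i (vertex_rep m) * y i)"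
      using False vertex_of_eq[OF m(1) e] by (simp add: vertex_matrix_def left_diff_distrib sum_subtractf)
    then show ?thesis using y[OF e'] unit[OF e'] unit[OF vertex_rep(2)[OF m(1)]] by simp
  qed simp
  have "0 = (\<Sum>i\<in>{1..num_ends}. vertex_matrix (vertex_rep m) i * y i)"
    using y[OF vertex_rep(2)[OF m(1)]] by simp
  also have "\<dots> = (\<Sum>i\<in>{1..num_ends}. \<Sum>e\<in>vertex G m. unit_coeff i e * y i)"
    by (simp add: vertex_matrix_def vertex_rep(3)[OF m(1)] sum_distrib_right)
  also have "\<dots> = (\<Sum>e\<in>vertex G m. \<Sum>i\<in>{1..num_ends}. unit_coeff i e * y i)" by (rule sum.swap)
  also have "\<dots> = (\<Sum>e\<in>vertex G m. y (vertex_rep m))"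
    using vertex_subset[OF m(1)] unit same by (intro sum.cong) auto
  also have "\<dots> = of_nat (valence G m) * y (vertex_rep m)" by (simp add: valence_def)
  finally have "y (vertex_rep m) = 0" using valence_pos[OF m(1)] by simp
  then show False using same[OF m(2)] j(2) by simp
qed

lemma prod_row_factor:
  "(\<Prod>r\<in>{1..num_ends}. row_factor \<alpha> k r)
     = poly (\<Prod>m\<in>{1..num_vertices G}. vertex_factor \<alpha> m) k
       * (\<Prod>r\<in>{1..num_ends}. if r = vertex_rep (vertex_of r) then 1
            else case vertex_mark G (vertex_of r) of Delta \<Rightarrow> 1 | Delta_prime \<Rightarrow> - k)"
proof -
  let ?R = "vertex_rep ` {1..num_vertices G}"
  have inj: "inj_on vertex_rep {1..num_vertices G}"
    using vertex_rep(3) by (metis inj_onI)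
  have R1: "?R \<subseteq> {1..num_ends}" using vertex_rep(2) by blast
  have R2: "r \<in> ?R \<longleftrightarrow> r = vertex_rep (vertex_of r)" if "r \<in> {1..num_ends}" for r
    using vertex_rep(3) vertex_of(1)[OF that] by auto
  have "(\<Prod>r\<in>{1..num_ends}. if r = vertex_rep (vertex_of r) then poly (vertex_factor \<alpha> (vertex_of r)) k else 1)
      = (\<Prod>r\<in>?R. poly (vertex_factor \<alpha> (vertex_of r)) k)"
  proof (rule prod.mono_neutral_cong_right)
    fix r assume "r \<in> ?R"
    then have "r = vertex_rep (vertex_of r)" using R1 R2 by blast
    then show "(if r = vertex_rep (vertex_of r) then poly (vertex_factor \<alpha> (vertex_of r)) k else 1)
        = poly (vertex_factor \<alpha> (vertex_of r)) k" by (rule if_P)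
  qed (use R1 R2 in auto)
  also have "\<dots> = (\<Prod>m\<in>{1..num_vertices G}. poly (vertex_factor \<alpha> m) k)"
    unfolding prod.reindex[OF inj] using vertex_rep(3) by (intro prod.cong) auto
  finally have "(\<Prod>r\<in>{1..num_ends}. if r = vertex_rep (vertex_of r) then poly (vertex_factor \<alpha> (vertex_of r)) k else 1)
      = poly (\<Prod>m\<in>{1..num_vertices G}. vertex_factor \<alpha> m) k" by (simp only: poly_prod)
  moreover have "(\<Prod>r\<in>{1..num_ends}. row_factor \<alpha> k r)
      = (\<Prod>r\<in>{1..num_ends}.
          (if r = vertex_rep (vertex_of r) then poly (vertex_factor \<alpha> (vertex_of r)) k else 1)
          * (if r = vertex_rep (vertex_of r) then 1
             else case vertex_mark G (vertex_of r) of Delta \<Rightarrow> 1 | Delta_prime \<Rightarrow> - k))"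
    by (rule prod.cong) (simp_all add: row_factor_def)
  ultimately show ?thesis by (simp only: prod.distrib)
qed

text \<open>
  In the exponential basis the two determinants are still proportional with the same constant, since the
  matrix \<open>exp_coeff\<close> of the change of basis does not involve the coupling constants.  Comparing
  the polynomials to which they are close, and cancelling the common factors, gives the claim.
\<close>

proposition isospectral_vertex_factors:
  assumes "isospectral (laplacian G \<alpha>) (laplacian G \<beta>)"
  obtains c where "c \<noteq> 0"
    "(\<Prod>m\<in>{1..num_vertices G}. vertex_factor \<beta> m) = Polynomial.smult c (\<Prod>m\<in>{1..num_vertices G}. vertex_factor \<alpha> m)"
proof -
  obtain c where c: "c \<noteq> 0" "\<And>z. secular_det \<beta> z = c * secular_det \<alpha> z"
    by (rule isospectral_secular_det[OF assms], rule that)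
  define F where "F \<gamma> k = square_det num_ends (\<lambda>r i. coupling_row \<gamma> r (unit_coeff i) (\<lambda>e. - of_real k * unit_coeff i e)
       + of_real (exp (- k * edge_length_at i))
         * coupling_row \<gamma> r (unit_coeff (opposite_end i)) (\<lambda>e. of_real k * unit_coeff (opposite_end i) e))"
    for \<gamma> :: "nat \<Rightarrow> real" and k :: real
  have F: "F \<gamma> k = secular_det \<gamma> (- ((of_real k)\<^sup>2)) * square_det num_ends (\<lambda>e i. exp_coeff (of_real k) i e)"
    if "k > 0" for \<gamma> k
    unfolding F_def secular_det_def square_det_mult[symmetric]
    using that by (intro square_det_cong)
      (simp only: secular_row_expand[symmetric], subst secular_row_exp_coeff, auto simp: exp_of_real[symmetric])
  have "\<exists>p. exp_close (F \<gamma>) p \<and> (\<forall>x. poly p x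
      = (\<Prod>r\<in>{1..num_ends}. row_factor \<gamma> x r) * square_det num_ends vertex_matrix)" for \<gamma>
  proof -
    define P where "P r i = [:coupling_row \<gamma> r (unit_coeff i) (\<lambda>e. 0), - coupling_row \<gamma> r (\<lambda>e. 0) (unit_coeff i):]" for r i
    have P: "poly (P r i) x = coupling_row \<gamma> r (unit_coeff i) (\<lambda>e. - x * unit_coeff i e)" for r i x
      unfolding coupling_row_affine P_def by simp
    have close: "exp_close (\<lambda>k. coupling_row \<gamma> r (unit_coeff i) (\<lambda>e. - of_real k * unit_coeff i e)
       + of_real (exp (- k * edge_length_at i))
         * coupling_row \<gamma> r (unit_coeff (opposite_end i)) (\<lambda>e. of_real k * unit_coeff (opposite_end i) e)) (P r i)"
      if "i \<in> {1..num_ends}" for r i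
    proof -
      have "edge_length_at i > 0"
        unfolding edge_length_at_def using edge_length_pos[OF endpoint_edge_bounds(1)[OF that]] .
      from exp_close_add[OF exp_close_poly[of "P r i"] exp_close_mult[OF exp_close_decaying_exp[OF this]
          exp_close_poly[of "[:coupling_row \<gamma> r (unit_coeff (opposite_end i)) (\<lambda>e. 0),
            coupling_row \<gamma> r (\<lambda>e. 0) (unit_coeff (opposite_end i)):]"]]]
      show ?thesis unfolding P unfolding coupling_row_affine[of _ _ _ "of_real _"] by simp
    qed
    show ?thesis
      using exp_close_square_det[of num_ends "\<lambda>k r i. coupling_row \<gamma> r (unit_coeff i) (\<lambda>e. - of_real k * unit_coeff i e)
       + of_real (exp (- k * edge_length_at i))
         * coupling_row \<gamma> r (unit_coeff (opposite_end i)) (\<lambda>e. of_real k * unit_coeff (opposite_end i) e)" P] close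
      unfolding P coupling_row_half_line square_det_scale_rows F_def by blast
  qed
  then obtain p where p: "\<And>\<gamma>. exp_close (F \<gamma>) (p \<gamma>)"
    "\<And>\<gamma> x. poly (p \<gamma>) x = (\<Prod>r\<in>{1..num_ends}. row_factor \<gamma> x r) * square_det num_ends vertex_matrix"
    by metis
  have "exp_close (F \<beta>) ([:c:] * p \<alpha>)"
  proof -
    have close: "exp_close (\<lambda>k. c * F \<alpha> k) ([:c:] * p \<alpha>)"
      by (rule exp_close_mult[OF exp_close_const p(1)])
    have "eventually (\<lambda>k::real. k > 0) at_top" by (rule eventually_gt_at_top)
    then have ev: "eventually (\<lambda>k. c * F \<alpha> k = F \<beta> k) at_top"
      by eventually_elim (simp add: F c(2))
    show ?thesis
      unfolding exp_close_def
    proof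
      fix m
      show "((\<lambda>k. of_real k ^ m * (F \<beta> k - poly ([:c:] * p \<alpha>) (of_real k))) \<longlongrightarrow> 0) at_top"
        by (rule Lim_transform_eventually[OF close[unfolded exp_close_def, rule_format, of m]])
          (use ev in eventually_elim, simp)
    qed
  qed
  then have eq: "p \<beta> = [:c:] * p \<alpha>" using exp_close_unique p(1) by blast
  let ?V = "\<lambda>\<gamma>. \<Prod>m\<in>{1..num_vertices G}. vertex_factor \<gamma> m"
  have "poly (?V \<beta> - Polynomial.smult c (?V \<alpha>)) x = 0" if "x \<noteq> 0" for x
  proof -
    have "(\<Prod>r\<in>{1..num_ends}. if r = vertex_rep (vertex_of r) then 1
            else case vertex_mark G (vertex_of r) of Delta \<Rightarrow> 1 | Delta_prime \<Rightarrow> - x) \<noteq> 0"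
      using that by (auto simp: prod_zero_iff split: vertex_type.splits)
    moreover have "poly (p \<beta>) x = c * poly (p \<alpha>) x" by (simp add: eq)
    ultimately show ?thesis
      using vertex_matrix_nonsingular unfolding p(2) prod_row_factor by (simp add: mult_ac)
  qed
  then have "- {0} \<subseteq> {x. poly (?V \<beta> - Polynomial.smult c (?V \<alpha>)) x = 0}" by auto
  moreover have "infinite (- {0 :: complex})" by (simp add: infinite_UNIV_char_0)
  ultimately have "?V \<beta> - Polynomial.smult c (?V \<alpha>) = 0"
    using poly_roots_finite finite_subset by blast
  then show ?thesis using that[OF c(1)] by simp
qed

lemma proots_vertex_factor:
  "vertex_factor \<alpha> m \<noteq> 0"
  "m \<in> {1..num_vertices G} \<Longrightarrow> proots (vertex_factor \<alpha> m) = (case vertex_mark G m of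
     Delta \<Rightarrow> {#of_real (- \<alpha> m / real (valence G m))#}
   | Delta_prime \<Rightarrow> if \<alpha> m = 0 then {#} else {#of_real (real (valence G m) / \<alpha> m)#})"
proof -
  show "vertex_factor \<alpha> m \<noteq> 0" by (auto simp: vertex_factor_def split: vertex_type.splits)
  assume m: "m \<in> {1..num_vertices G}"
  show "proots (vertex_factor \<alpha> m) = (case vertex_mark G m of
     Delta \<Rightarrow> {#of_real (- \<alpha> m / real (valence G m))#}
   | Delta_prime \<Rightarrow> if \<alpha> m = 0 then {#} else {#of_real (real (valence G m) / \<alpha> m)#})"
  proof (cases "vertex_mark G m")
    case Delta
    have "vertex_factor \<alpha> m = Polynomial.smult (-1) [:of_real (\<alpha> m / real (valence G m)), 1:]"
      using Delta by (simp add: vertex_factor_def)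
    also have "proots \<dots> = {#- of_real (\<alpha> m / real (valence G m))#}"
      by (subst proots_smult) auto
    finally show ?thesis using Delta by simp
  next
    case Delta_prime
    show ?thesis
    proof (cases "\<alpha> m = 0")
      case False
      let ?x = "complex_of_real (\<alpha> m / real (valence G m))"
      have x: "?x \<noteq> 0" using False valence_pos[OF m] by simp
      have "vertex_factor \<alpha> m = Polynomial.smult ?x [:- (1 / ?x), 1:]"
        using Delta_prime x by (simp add: vertex_factor_def)
      also have "proots \<dots> = {#1 / ?x#}"
        using x by (subst proots_smult) auto
      finally show ?thesis using Delta_prime False by simp
    qed (simp add: Delta_prime vertex_factor_def proots_const)
  qed
qed

end

section \<open>The vertex roots\<close>

lemma sum_mset_image_sum:
  "(\<Sum>x\<in>#(\<Sum>i\<in>I. f i). h x) = (\<Sum>i\<in>I. \<Sum>x\<in>#f i. h x)"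
  for h :: "'a \<Rightarrow> 'b :: comm_monoid_add"
  by (induction I rule: infinite_finite_induct) simp_all

context metric_graph
begin

lemma isospectral_vertex_roots:
  assumes "isospectral (laplacian G \<alpha>) (laplacian G \<beta>)"
  shows "(\<Sum>m\<in>{1..num_vertices G}. proots (vertex_factor \<alpha> m))
       = (\<Sum>m\<in>{1..num_vertices G}. proots (vertex_factor \<beta> m))"
proof -
  obtain c where c: "c \<noteq> 0" "(\<Prod>m\<in>{1..num_vertices G}. vertex_factor \<beta> m)
      = Polynomial.smult c (\<Prod>m\<in>{1..num_vertices G}. vertex_factor \<alpha> m)"
    by (rule isospectral_vertex_factors[OF assms], rule that)
  have "proots (\<Prod>m\<in>{1..num_vertices G}. vertex_factor \<gamma> m)
      = (\<Sum>m\<in>{1..num_vertices G}. proots (vertex_factor \<gamma> m))" for \<gamma>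
    using proots_vertex_factor(1) by (rule proots_prod)
  then show ?thesis using c by (metis proots_smult)
qed

lemma sum_over_marked_vertices:
  fixes h :: "complex \<Rightarrow> 'a :: comm_monoid_add"
  assumes "N \<le> num_vertices G"
    and "\<And>i. i \<in> {1..N} \<Longrightarrow> vertex_mark G i = Delta"
    and "\<And>i. i \<in> {N + 1..num_vertices G} \<Longrightarrow> vertex_mark G i = Delta_prime"
  shows "(\<Sum>m\<in>{1..num_vertices G}. \<Sum>x\<in>#proots (vertex_factor \<alpha> m). h x)
     = (\<Sum>i\<in>{1..N}. h (of_real (- \<alpha> i / real (valence G i))))
       + (\<Sum>i\<in>{i \<in> {N + 1..num_vertices G}. \<alpha> i \<noteq> 0}. h (of_real (real (valence G i) / \<alpha> i)))"
proof -
  let ?g = "\<lambda>m. \<Sum>x\<in>#proots (vertex_factor \<alpha> m). h x"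
  have "{1..num_vertices G} = {1..N} \<union> {N + 1..num_vertices G}" using assms(1) by auto
  then have "(\<Sum>m\<in>{1..num_vertices G}. ?g m) = (\<Sum>m\<in>{1..N}. ?g m) + (\<Sum>m\<in>{N + 1..num_vertices G}. ?g m)"
    by (simp only:) (rule sum.union_disjoint; auto)
  also have "(\<Sum>m\<in>{1..N}. ?g m) = (\<Sum>i\<in>{1..N}. h (of_real (- \<alpha> i / real (valence G i))))"
    using assms(1,2) by (intro sum.cong) (simp_all add: proots_vertex_factor(2))
  also have "(\<Sum>m\<in>{N + 1..num_vertices G}. ?g m)
      = (\<Sum>i\<in>{N + 1..num_vertices G}. if \<alpha> i \<noteq> 0 then h (of_real (real (valence G i) / \<alpha> i)) else 0)"
    using assms(3) by (intro sum.cong) (simp_all add: proots_vertex_factor(2))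
  also have "\<dots> = (\<Sum>i\<in>{i \<in> {N + 1..num_vertices G}. \<alpha> i \<noteq> 0}. h (of_real (real (valence G i) / \<alpha> i)))"
    by (rule sum.inter_filter[symmetric]) simp
  finally show ?thesis .
qed

end

theorem theorem4p1:
  fixes G :: marked_graph and N\<^sub>1 :: nat and \<alpha> \<alpha>' :: "nat \<Rightarrow> real"
  assumes "is_marked_graph G"
    and "N\<^sub>1 \<le> num_vertices G"
    and "\<And>i. i \<in> {1..N\<^sub>1} \<Longrightarrow> vertex_mark G i = Delta"
    and "\<And>i. i \<in> {N\<^sub>1 + 1..num_vertices G} \<Longrightarrow> vertex_mark G i = Delta_prime"
    and "isospectral (laplacian G \<alpha>) (laplacian G \<alpha>')"
  shows "(\<forall>m::nat. m \<ge> 1 \<longrightarrow>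
            (\<Sum>i\<in>{1..N\<^sub>1}. (- \<alpha> i) ^ m / real (valence G i) ^ m) +
            (\<Sum>i\<in>{i \<in> {N\<^sub>1 + 1..num_vertices G}. \<alpha> i \<noteq> 0}. real (valence G i) ^ m / \<alpha> i ^ m)
          = (\<Sum>i\<in>{1..N\<^sub>1}. (- \<alpha>' i) ^ m / real (valence G i) ^ m) +
            (\<Sum>i\<in>{i \<in> {N\<^sub>1 + 1..num_vertices G}. \<alpha>' i \<noteq> 0}. real (valence G i) ^ m / \<alpha>' i ^ m))
       \<and> card {i \<in> {N\<^sub>1 + 1..num_vertices G}. \<alpha> i = 0}
          = card {i \<in> {N\<^sub>1 + 1..num_vertices G}. \<alpha>' i = 0}"
proof -
  interpret metric_graph G by unfold_locales (rule assms(1))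
  note split = sum_over_marked_vertices[OF assms(2-4)]
  have roots: "(\<Sum>m\<in>{1..num_vertices G}. \<Sum>x\<in>#proots (vertex_factor \<alpha> m). h x)
      = (\<Sum>m\<in>{1..num_vertices G}. \<Sum>x\<in>#proots (vertex_factor \<alpha>' m). h x)"
    for h :: "complex \<Rightarrow> 'b :: comm_monoid_add"
    unfolding sum_mset_image_sum[symmetric] isospectral_vertex_roots[OF assms(5)] ..
  have "(\<Sum>i\<in>{1..N\<^sub>1}. (- \<alpha> i) ^ m / real (valence G i) ^ m) +
            (\<Sum>i\<in>{i \<in> {N\<^sub>1 + 1..num_vertices G}. \<alpha> i \<noteq> 0}. real (valence G i) ^ m / \<alpha> i ^ m)
          = (\<Sum>i\<in>{1..N\<^sub>1}. (- \<alpha>' i) ^ m / real (valence G i) ^ m) +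
            (\<Sum>i\<in>{i \<in> {N\<^sub>1 + 1..num_vertices G}. \<alpha>' i \<noteq> 0}. real (valence G i) ^ m / \<alpha>' i ^ m)" for m
    using roots[of "\<lambda>x. Re (x ^ m)"] split[of "\<lambda>x. Re (x ^ m)" \<alpha>] split[of "\<lambda>x. Re (x ^ m)" \<alpha>']
    by (simp only: of_real_power[symmetric] Re_complex_of_real power_divide)
  moreover have "card {i \<in> {N\<^sub>1 + 1..num_vertices G}. \<alpha> i = 0}
          = card {i \<in> {N\<^sub>1 + 1..num_vertices G}. \<alpha>' i = 0}"
  proof -
    have "card {i \<in> {N\<^sub>1 + 1..num_vertices G}. \<alpha> i \<noteq> 0} = card {i \<in> {N\<^sub>1 + 1..num_vertices G}. \<alpha>' i \<noteq> 0}"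
      using roots[of "\<lambda>x. 1 :: nat"] split[of "\<lambda>x. 1 :: nat" \<alpha>] split[of "\<lambda>x. 1 :: nat" \<alpha>'] by simp
    moreover have count: "card {i \<in> A. \<gamma> i = 0} + card {i \<in> A. \<gamma> i \<noteq> 0} = card A"
      if "finite A" for A and \<gamma> :: "nat \<Rightarrow> real"
    proof -
      have "{i \<in> A. \<gamma> i = 0} \<union> {i \<in> A. \<gamma> i \<noteq> 0} = A" by blast
      moreover have "{i \<in> A. \<gamma> i = 0} \<inter> {i \<in> A. \<gamma> i \<noteq> 0} = {}" by blast
      ultimately show ?thesis using that by (metis card_Un_disjoint finite_Un)
    qed
    ultimately show ?thesis
      using count[of "{N\<^sub>1 + 1..num_vertices G}" \<alpha>] count[of "{N\<^sub>1 + 1..num_vertices G}" \<alpha>'] by simp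
  qed
  ultimately show ?thesis by blast
qed

end
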